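(* Let $n\ge2$, let $C\subset\mathbb C^n$ be a complex cone, and let $1\le p\le2$. The following are equivalent: (i) every $f\in L^p(\mathbb C^n)$ with $f\times\mu_r(z)=0$ for all $z\in C$ and all $r>0$ satisfies $f=0$ a.e. on $\mathbb C^n$; (ii) $C\nsubseteq P_{s,t}^{-1}(0)$ for all $s,t\in\mathbb Z_+$ and all non-zero $P_{s,t}\in H_{s,t}$.
   Context: $\mathbb Z_+=\{0,1,2,\dots\}$. A complex cone in $\mathbb C^n$ ($n\ge2$) is a non-empty set $C\subset\mathbb C^n$ such that $\lambda C\subseteq C$ for all $\lambda\in\mathbb C$. $\mu_r$ is the normalized surface measure on the sphere $S_r(o)=\{z\in\mathbb C^n:|z|=r\}$, and the twisted spherical mean of $f$ is $f\times\mu_r(z)=\int_{S_r(o)}f(z-w)e^{\frac i2\mathrm{Im}(z\cdot\bar w)}\,d\mu_r(w)$, with $z\cdot\bar w=\sum_j z_j\bar w_j$. $H_{s,t}$ is the space of polynomials $P(z)=\sum_{|\alpha|=s}\sum_{|\beta|=t}c_{\alpha\beta}z^\alpha\bar z^\beta$ on $\mathbb C^n$ with $\Delta P=0$. *)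

theory Defs
  imports "HOL-Analysis.Analysis"
begin

definition is_complex_cone :: "(complex ^ 'n) set \<Rightarrow> bool" where
  "is_complex_cone C \<longleftrightarrow> C \<noteq> {} \<and> (\<forall>c. (\<lambda>z. c *s z) ` C \<subseteq> C)"

definition Lp :: "real \<Rightarrow> ('a::euclidean_space \<Rightarrow> complex) set" where
  "Lp p = {f \<in> borel_measurable lebesgue. integrable lebesgue (\<lambda>z. norm (f z) powr p)}"

text \<open>
  The normalized surface measure on the sphere of radius \<open>r\<close> about the origin. As usual in polar
  coordinates, the measure of a Borel set \<open>E\<close> of the sphere is the normalized volume of the cone
  over \<open>E\<close>, that is, of the set of all \<open>x \<noteq> 0\<close> in the unit ball with \<open>(r / |x|) x \<in> E\<close>.
  The result is completed, because the members of \<open>Lp p\<close> are only assumed to be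
  Lebesgue measurable: on almost every sphere about a given centre such a function
  is measurable for the completed measure.
\<close>
definition sphere_measure :: "real \<Rightarrow> 'a::euclidean_space measure" where
  "sphere_measure r =
     completion (distr (uniform_measure lborel (ball 0 1)) borel (\<lambda>x. (r / norm x) *\<^sub>R x))"

lemma emeasure_sphere_measure_sphere:
  assumes "r > 0"
  shows "emeasure (sphere_measure r :: 'a::euclidean_space measure) (sphere 0 r) = 1"
    and "emeasure (sphere_measure r :: 'a::euclidean_space measure) UNIV = 1"
proof -
  let ?B = "ball 0 1 :: 'a set"
  let ?U = "uniform_measure lborel ?B"
  let ?p = "\<lambda>x::'a. (r / norm x) *\<^sub>R x"
  have meas: "?p \<in> measurable ?U borel" by measurable
  have pos: "emeasure lborel ?B \<noteq> 0"
    using open_not_negligible[of ?B] by (auto simp: negligible_iff_emeasure0)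
  have fin: "emeasure lborel ?B \<noteq> \<infinity>"
    using emeasure_lborel_ball_finite[of "0::'a" 1] by simp
  have U1: "emeasure ?U UNIV = 1"
    using emeasure_uniform_measure_1[OF pos fin] by (simp add: emeasure_uniform_measure pos fin)
  have "emeasure (distr ?U borel ?p) (sphere 0 r) = emeasure ?U (?p -` sphere 0 r)"
    by (subst emeasure_distr[OF meas]) auto
  also have "?p -` sphere 0 r = UNIV - {0}"
    using assms by auto
  also have "emeasure ?U (UNIV - {0}) = emeasure ?U UNIV"
  proof (rule emeasure_Diff_null_set)
    show "{0} \<in> null_sets ?U"
      by (auto simp: null_sets_def intro: emeasure_eq_0[of "{0::'a}"])
  qed auto
  finally have S: "emeasure (distr ?U borel ?p) (sphere 0 r) = 1" using U1 by simp
  show "emeasure (sphere_measure r :: 'a measure) (sphere 0 r) = 1"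
    unfolding sphere_measure_def by (subst emeasure_completion) (use S in auto)
  have "emeasure (distr ?U borel ?p) UNIV = 1"
    by (subst emeasure_distr[OF meas]) (use U1 in auto)
  then show "emeasure (sphere_measure r :: 'a measure) UNIV = 1"
    unfolding sphere_measure_def by (subst emeasure_completion) auto
qed

text \<open>
  The twisted spherical mean of \<open>f\<close> over spheres of radius \<open>r\<close>. For \<open>f \<in> Lp p\<close> with \<open>p \<ge> 1\<close> and a
  given \<open>z\<close>, the integral exists for almost every \<open>r > 0\<close>; at the exceptional radii the value is \<open>0\<close>
  by the convention for the Bochner integral.
\<close>
definition twisted_spherical_mean ::
    "(complex ^ 'n \<Rightarrow> complex) \<Rightarrow> real \<Rightarrow> complex ^ 'n \<Rightarrow> complex" where
  "twisted_spherical_mean f r z =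
     (LINT w|sphere_measure r.
        f (z - w) * exp (\<i> / 2 * of_real (Im (\<Sum>j\<in>UNIV. z $ j * cnj (w $ j)))))"

definition directional_deriv ::
    "'a::real_normed_vector \<Rightarrow> ('a \<Rightarrow> 'b::real_normed_vector) \<Rightarrow> 'a \<Rightarrow> 'b" where
  "directional_deriv b f z = vector_derivative (\<lambda>t. f (z + t *\<^sub>R b)) (at 0)"

text \<open>
  On \<open>complex ^ 'n\<close> the basis vectors are \<open>axis j 1\<close> and \<open>axis j \<i>\<close>, so this is the sum of all second
  derivatives with respect to the real coordinates \<open>x\<^sub>j\<close> and \<open>y\<^sub>j\<close>, where \<open>z\<^sub>j = x\<^sub>j + \<i> y\<^sub>j\<close>.
\<close>
definition laplacian :: "('a::euclidean_space \<Rightarrow> 'b::real_normed_vector) \<Rightarrow> 'a \<Rightarrow> 'b" where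
  "laplacian f z = (\<Sum>b\<in>Basis. directional_deriv b (directional_deriv b f) z)"

definition multi_indices :: "nat \<Rightarrow> ('n::finite \<Rightarrow> nat) set" where
  "multi_indices d = {\<alpha>. (\<Sum>j\<in>UNIV. \<alpha> j) = d}"

definition bihomogeneous_poly ::
    "nat \<Rightarrow> nat \<Rightarrow> (('n::finite \<Rightarrow> nat) \<Rightarrow> ('n \<Rightarrow> nat) \<Rightarrow> complex) \<Rightarrow> complex ^ 'n \<Rightarrow> complex" where
  "bihomogeneous_poly s t c z =
     (\<Sum>\<alpha>\<in>multi_indices s. \<Sum>\<beta>\<in>multi_indices t.
        c \<alpha> \<beta> * (\<Prod>j\<in>UNIV. (z $ j) ^ \<alpha> j) * (\<Prod>j\<in>UNIV. cnj (z $ j) ^ \<beta> j))"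

lemma finite_multi_indices: "finite (multi_indices d :: ('n::finite \<Rightarrow> nat) set)"
proof (rule finite_subset)
  show "multi_indices d \<subseteq> PiE (UNIV :: 'n set) (\<lambda>_. {..d})"
    by (auto simp: multi_indices_def PiE_def intro!: member_le_sum)
qed (auto intro: finite_PiE)

definition solid_harmonics :: "nat \<Rightarrow> nat \<Rightarrow> (complex ^ 'n \<Rightarrow> complex) set" where
  "solid_harmonics s t =
     {P. (\<exists>c. P = bihomogeneous_poly s t c) \<and> (\<forall>z. laplacian P z = 0)}"

end

theory Submission
  imports Defs "HOL-Probability.Distributions"
begin

text \<open>
  Write \<open>hprod u z\<close> for the Hermitian product \<open>u \<cdot> cnj z\<close>. Integrating the twisted spherical means of
  \<open>f\<close> at \<open>z\<close> against \<open>exp (- a r\<^sup>2 / 4)\<close> in polar coordinates gives, up to a non-zero factor,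

    \<open>\<integral>u. f u * exp (- a \<bar>u\<bar>\<^sup>2 / 4) * exp ((a + 1) / 4 * hprod u z + (a - 1) / 4 * hprod z u)\<close>

  (lemma \<open>twisted_gaussian_convolution\<close>). If the means vanish on a complex cone, \<open>z\<close> may be replaced
  by \<open>\<lambda> z\<close>. This is a power series in \<open>\<lambda>\<close> and its conjugate, so all the mixed moments

    \<open>\<integral>u. f u * exp (- a \<bar>u\<bar>\<^sup>2 / 4) * hprod u z ^ q * hprod z u ^ p\<close>

  vanish for \<open>z\<close> in the cone (\<open>mixed_moments_eq_0_if_exp_integral_eq_0\<close>).

  Suppose that no non-zero solid harmonic vanishes on the cone. The mixed moment of bidegree \<open>(p, q)\<close> is a
  bihomogeneous polynomial in \<open>z\<close>, and its Laplacian is a multiple of the derivative in \<open>a\<close> of the moment of bidegree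
  \<open>(p - 1, q - 1)\<close>. By induction on the bidegree each moment is harmonic, and therefore zero on the
  whole space (\<open>mixed_moments_eq_0_everywhere\<close>). Summing the exponential series again, \<open>f\<close> times a Gaussian is orthogonal
  to all translated Gaussians, and so \<open>f = 0\<close> almost everywhere (\<open>AE_eq_0_if_gaussian_convolutions_eq_0\<close>).

  Conversely, let \<open>P\<close> be a non-zero solid harmonic that vanishes on the cone, and \<open>f z = P z * exp (- \<bar>z\<bar>\<^sup>2 / 4)\<close>. The
  mean value property with respect to Gaussians (\<open>gaussian_mean_value\<close>) gives, for every \<open>\<lambda>\<close>,

    \<open>\<integral>u. P u * exp (- b \<bar>u\<bar>\<^sup>2) * exp (b * hprod u (\<lambda> z) + b * hprod (\<lambda> z) u) = c * P (\<lambda> z)\<close>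

  with a factor \<open>c\<close> that does not involve \<open>P\<close>. For \<open>z\<close> in the cone the right-hand side is \<open>0\<close>, so again all mixed moments at \<open>z\<close>
  vanish. Then the displayed integral above vanishes for every \<open>a\<close>, and uniqueness of the Gaussian
  transform in the radius (\<open>half_line_gaussian_uniqueness\<close>) shows that all twisted spherical means of
  \<open>f\<close> at \<open>z\<close> are \<open>0\<close>.
\<close>

section \<open>Functions that stay integrable against exponentials\<close>

text \<open>
  The pair of classes \<open>exp_growth\<close> and \<open>exp_integrable\<close> is chosen so that products of a member
  of the first with a member of the second stay in the second. Polynomials and exponentials of
  linear forms lie in the first; an \<open>L\<^sup>p\<close> function times a Gaussian lies in the second. These
  memberships settle most convergence questions below.
\<close>
definition exp_growth :: "('a::euclidean_space \<Rightarrow> complex) \<Rightarrow> bool" where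
  "exp_growth g \<longleftrightarrow> g \<in> borel_measurable borel \<and> (\<exists>C R. \<forall>u. norm (g u) \<le> C * exp (R * norm u))"

definition exp_integrable :: "('a::euclidean_space \<Rightarrow> complex) \<Rightarrow> bool" where
  "exp_integrable K \<longleftrightarrow>
     K \<in> borel_measurable borel \<and> (\<forall>R. integrable lborel (\<lambda>u. exp (R * norm u) *\<^sub>R K u))"

abbreviation gaussian :: "real \<Rightarrow> 'a::euclidean_space \<Rightarrow> complex" where
  "gaussian b u \<equiv> of_real (exp (- b * (norm u)\<^sup>2))"

lemma exp_growth_measurable [measurable_dest]: "exp_growth g \<Longrightarrow> g \<in> borel_measurable borel"
  and exp_integrable_measurable [measurable_dest]:
    "exp_integrable K \<Longrightarrow> K \<in> borel_measurable borel"
  by (auto simp: exp_growth_def exp_integrable_def)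

lemma exp_growthI:
  assumes "g \<in> borel_measurable borel" "\<And>u. norm (g u) \<le> C * exp (R * norm u)"
  shows "exp_growth g"
  using assms unfolding exp_growth_def by blast

lemma exp_growthE:
  assumes "exp_growth g"
  obtains C R where "C \<ge> 0" "R \<ge> 0" "\<And>u. norm (g u) \<le> C * exp (R * norm u)"
proof -
  obtain C R where CR: "\<And>u. norm (g u) \<le> C * exp (R * norm u)"
    using assms unfolding exp_growth_def by blast
  have "norm (g u) \<le> \<bar>C\<bar> * exp (\<bar>R\<bar> * norm u)" for u
  proof -
    have "C * exp (R * norm u) \<le> \<bar>C\<bar> * exp (\<bar>R\<bar> * norm u)"
      by (intro mult_mono) (auto intro: mult_right_mono)
    then show ?thesis using CR[of u] by linarith
  qed
  then show thesis using that[of "\<bar>C\<bar>" "\<bar>R\<bar>"] by simp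
qed

lemma exp_growth_const [simp, intro]: "exp_growth (\<lambda>_. c)"
  by (rule exp_growthI[where C = "norm c" and R = 0]) auto

lemma exp_growth_add [intro]:
  assumes "exp_growth f" "exp_growth g"
  shows "exp_growth (\<lambda>u. f u + g u)"
proof -
  obtain C R where f: "C \<ge> 0" "R \<ge> 0" "\<And>u. norm (f u) \<le> C * exp (R * norm u)"
    using exp_growthE[OF assms(1)] by blast
  obtain C' R' where g: "C' \<ge> 0" "R' \<ge> 0" "\<And>u. norm (g u) \<le> C' * exp (R' * norm u)"
    using exp_growthE[OF assms(2)] by blast
  show ?thesis
  proof (rule exp_growthI)
    show "(\<lambda>u. f u + g u) \<in> borel_measurable borel" using assms by measurable
    fix u :: 'a
    have "C * exp (R * norm u) \<le> C * exp ((R + R') * norm u)"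
         "C' * exp (R' * norm u) \<le> C' * exp ((R + R') * norm u)"
      using f(1,2) g(1,2) by (auto intro!: mult_left_mono mult_right_mono)
    then show "norm (f u + g u) \<le> (C + C') * exp ((R + R') * norm u)"
      using f(3)[of u] g(3)[of u] norm_triangle_ineq[of "f u" "g u"]
      by (simp add: distrib_right)
  qed
qed

lemma exp_growth_mult [intro]:
  assumes "exp_growth f" "exp_growth g"
  shows "exp_growth (\<lambda>u. f u * g u)"
proof -
  obtain C R where f: "C \<ge> 0" "R \<ge> 0" "\<And>u. norm (f u) \<le> C * exp (R * norm u)"
    using exp_growthE[OF assms(1)] by blast
  obtain C' R' where g: "C' \<ge> 0" "R' \<ge> 0" "\<And>u. norm (g u) \<le> C' * exp (R' * norm u)"
    using exp_growthE[OF assms(2)] by blast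
  show ?thesis
  proof (rule exp_growthI)
    show "(\<lambda>u. f u * g u) \<in> borel_measurable borel" using assms by measurable
    fix u :: 'a
    have "norm (f u * g u) \<le> (C * exp (R * norm u)) * (C' * exp (R' * norm u))"
      unfolding norm_mult using f g by (intro mult_mono) auto
    then show "norm (f u * g u) \<le> (C * C') * exp ((R + R') * norm u)"
      by (simp add: distrib_right distrib_left exp_add mult_ac)
  qed
qed

lemma exp_growth_power [intro]: "exp_growth f \<Longrightarrow> exp_growth (\<lambda>u. f u ^ n)"
  by (induction n) auto

lemma exp_growth_linear [intro]:
  assumes "bounded_linear h"
  shows "exp_growth (h :: 'a::euclidean_space \<Rightarrow> complex)"
proof -
  obtain M where M: "\<And>x. norm (h x) \<le> norm x * M" "M > 0"
    using bounded_linear.pos_bounded[OF assms] by blast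
  show ?thesis
  proof (rule exp_growthI)
    show "h \<in> borel_measurable borel"
      using assms by (intro borel_measurable_continuous_onI linear_continuous_on)
    fix u :: 'a
    have "norm u * M \<le> M * exp (1 * norm u)"
      using M(2) exp_ge_add_one_self[of "norm u"] by (simp add: mult.commute order_trans[of _ "1 + norm u"])
    then show "norm (h u) \<le> M * exp (1 * norm u)" using M(1)[of u] by simp
  qed
qed

text \<open>The quadratic exponent of a Gaussian beats every linear one: complete the square.\<close>

lemma exp_linear_le_exp_quadratic:
  assumes "(b::real) > 0"
  shows "exp (R * r) \<le> exp (R\<^sup>2 / (4 * b)) * exp (b * r\<^sup>2)"
proof -
  have "0 \<le> (2 * b * r - R)\<^sup>2 / (4 * b)" using assms by simp
  also have "\<dots> = b * r\<^sup>2 - R * r + R\<^sup>2 / (4 * b)"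
    using assms by (simp add: power2_eq_square field_simps)
  finally have "R * r \<le> R\<^sup>2 / (4 * b) + b * r\<^sup>2" by simp
  then show ?thesis by (simp flip: exp_add)
qed

lemma exp_integrable_integrable:
  assumes "exp_integrable K" shows "integrable lborel K"
proof -
  have "integrable lborel (\<lambda>u. exp (0 * norm u) *\<^sub>R K u)"
    using assms unfolding exp_integrable_def by blast
  then show ?thesis by simp
qed

lemma exp_integrable_mult [intro]:
  assumes "exp_growth g" "exp_integrable K"
  shows "exp_integrable (\<lambda>u. g u * K u)"
  unfolding exp_integrable_def
proof (intro conjI allI)
  show "(\<lambda>u. g u * K u) \<in> borel_measurable borel" using assms by measurable
  fix R :: real
  obtain C S where f: "C \<ge> 0" "S \<ge> 0" "\<And>u. norm (g u) \<le> C * exp (S * norm u)"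
    using exp_growthE[OF assms(1)] by blast
  have "integrable lborel (\<lambda>u. C *\<^sub>R (exp ((R + S) * norm u) *\<^sub>R K u))"
    using assms(2) unfolding exp_integrable_def by (intro integrable_scaleR_right) blast
  then show "integrable lborel (\<lambda>u. exp (R * norm u) *\<^sub>R (g u * K u))"
  proof (rule Bochner_Integration.integrable_bound)
    show "(\<lambda>u. exp (R * norm u) *\<^sub>R (g u * K u)) \<in> borel_measurable lborel"
      using assms by measurable
    have "exp (R * norm u) * (norm (g u) * norm (K u)) \<le> \<bar>C\<bar> * (exp ((R + S) * norm u) * norm (K u))" for u
    proof -
      have "exp (R * norm u) * (norm (g u) * norm (K u)) \<le>
            exp (R * norm u) * ((C * exp (S * norm u)) * norm (K u))"
        using f(3)[of u] by (intro mult_left_mono mult_right_mono) auto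
      then show ?thesis using f(1) by (simp add: distrib_right distrib_left exp_add mult_ac)
    qed
    then show "AE u in lborel. norm (exp (R * norm u) *\<^sub>R (g u * K u))
        \<le> norm (C *\<^sub>R (exp ((R + S) * norm u) *\<^sub>R K u))"
      by (simp add: norm_mult abs_mult mult_ac)
  qed
qed

lemma integrable_gaussian:
  assumes "b > 0"
  shows "integrable lborel (\<lambda>u::'a::euclidean_space. exp (- b * (norm u)\<^sup>2))"
proof (rule integrableI_bounded)
  define \<sigma> where "\<sigma> = 1 / sqrt (2 * b)"
  have \<sigma>: "\<sigma> > 0" "2 * \<sigma>\<^sup>2 = 1 / b" using assms by (auto simp: \<sigma>_def power_divide)
  have eq: "exp (- b * x\<^sup>2) = sqrt (2 * pi * \<sigma>\<^sup>2) * normal_density 0 \<sigma> x" for x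
    using \<sigma> assms by (simp add: normal_density_def mult.commute)
  have "integrable lborel (\<lambda>x. sqrt (2 * pi * \<sigma>\<^sup>2) * normal_density 0 \<sigma> x)"
    using \<sigma> by (intro integrable_mult_right integrable_normal_density)
  then have "integrable lborel (\<lambda>x. exp (- b * x\<^sup>2))" by (simp only: eq)
  then have fin: "(\<integral>\<^sup>+x. ennreal (exp (- b * x\<^sup>2)) \<partial>lborel) < \<infinity>"
    by (simp add: integrable_iff_bounded)
  have "(\<integral>\<^sup>+u. ennreal (norm (exp (- b * (norm (u::'a))\<^sup>2))) \<partial>lborel) =
        (\<integral>\<^sup>+u. (\<Prod>i\<in>Basis. ennreal (exp (- b * ((u::'a) \<bullet> i)\<^sup>2))) \<partial>lborel)"
  proof (intro nn_integral_cong)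
    fix u :: 'a
    have "(norm u)\<^sup>2 = (\<Sum>i\<in>Basis. (u \<bullet> i)\<^sup>2)"
      by (simp add: norm_eq_sqrt_inner euclidean_inner[of u u] power2_eq_square sum_nonneg)
    then have "exp (- b * (norm u)\<^sup>2) = (\<Prod>i\<in>Basis. exp (- b * (u \<bullet> i)\<^sup>2))"
      by (simp add: exp_sum sum_negf[symmetric] sum_distrib_left)
    then show "ennreal (norm (exp (- b * (norm u)\<^sup>2))) =
        (\<Prod>i\<in>Basis. ennreal (exp (- b * (u \<bullet> i)\<^sup>2)))"
      by (simp add: prod_ennreal prod_nonneg)
  qed
  also have "\<dots> = (\<Prod>i\<in>(Basis::'a set). \<integral>\<^sup>+x. ennreal (exp (- b * x\<^sup>2)) \<partial>lborel)"
    by (rule nn_integral_lborel_prod) auto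
  also have "\<dots> < \<infinity>" using fin by (simp add: power_less_top_ennreal)
  finally show "(\<integral>\<^sup>+u. ennreal (norm (exp (- b * (norm (u::'a))\<^sup>2))) \<partial>lborel) < \<infinity>" .
qed simp

lemma exp_integrable_gaussian [intro]:
  assumes "b > 0"
  shows "exp_integrable (gaussian b :: 'a::euclidean_space \<Rightarrow> complex)"
  unfolding exp_integrable_def
proof (intro conjI allI)
  fix R :: real
  have "integrable lborel (\<lambda>u::'a. exp (R\<^sup>2 / (4 * (b / 2))) * exp (- (b / 2) * (norm u)\<^sup>2))"
    using assms by (intro integrable_mult_right integrable_gaussian) auto
  then show "integrable lborel (\<lambda>u::'a. exp (R * norm u) *\<^sub>R gaussian b u)"
  proof (rule Bochner_Integration.integrable_bound)
    have "exp (R * norm u) * exp (- b * (norm u)\<^sup>2) \<le>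
          exp (R\<^sup>2 / (4 * (b / 2))) * exp (- (b / 2) * (norm u)\<^sup>2)" for u :: 'a
    proof -
      have "exp (R * norm u) * exp (- b * (norm u)\<^sup>2) \<le>
            (exp (R\<^sup>2 / (4 * (b / 2))) * exp ((b / 2) * (norm u)\<^sup>2)) * exp (- b * (norm u)\<^sup>2)"
        using assms by (intro mult_right_mono exp_linear_le_exp_quadratic) auto
      also have "\<dots> = exp (R\<^sup>2 / (4 * (b / 2))) * exp (- (b / 2) * (norm u)\<^sup>2)"
        by (simp flip: exp_add)
      finally show ?thesis .
    qed
    then show "AE u::'a in lborel. norm (exp (R * norm u) *\<^sub>R gaussian b u) \<le>
       norm (exp (R\<^sup>2 / (4 * (b / 2))) * exp (- (b / 2) * (norm u)\<^sup>2))"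
      by (simp add: norm_mult)
  qed measurable
qed measurable

section \<open>Exponential integrals and moments\<close>

text \<open>
  The partial sums of the exponential series are dominated by \<open>exp \<bar>A\<bar>\<close>, which is integrable
  against \<open>K\<close>, so the series may be integrated term by term.
\<close>
lemma exp_integral_sums_moments:
  fixes K A :: "'a \<Rightarrow> complex"
  assumes [measurable]: "K \<in> borel_measurable M" "A \<in> borel_measurable M"
    and int: "integrable M (\<lambda>u. exp (norm (A u)) *\<^sub>R K u)"
  shows "(\<lambda>d. (\<integral>u. K u * A u ^ d \<partial>M) / fact d) sums (\<integral>u. K u * exp (A u) \<partial>M)"
    and "integrable M (\<lambda>u. K u * A u ^ d)"
proof -
  let ?f = "\<lambda>d u. K u * A u ^ d /\<^sub>R fact d"
  have exps: "(\<lambda>d. norm (?f d u)) sums (norm (K u) * exp (norm (A u)))" for u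
    using sums_mult[OF exp_converges[of "norm (A u)"], of "norm (K u)"]
    by (simp add: norm_mult norm_power mult_ac)
  have int': "integrable M (\<lambda>u. norm (K u) * exp (norm (A u)))"
    using integrable_norm[OF int] by (simp add: mult.commute)
  have le: "(\<Sum>d<n. norm (?f d u)) \<le> norm (K u) * exp (norm (A u))" for n u
    using sum_le_suminf[OF sums_summable[OF exps[of u]], of "{..<n}"] sums_unique[OF exps[of u]]
    by simp
  have intf: "integrable M (?f d)" for d
  proof (rule Bochner_Integration.integrable_bound[OF int'])
    have "norm (?f d u) \<le> norm (K u) * exp (norm (A u))" for u
      using le[of u "Suc d"] sum_nonneg[of "{..<d}" "\<lambda>d. norm (?f d u)"] by simp
    then show "AE u in M. norm (?f d u) \<le> norm (norm (K u) * exp (norm (A u)))"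
      by (intro AE_I2) (auto intro: order_trans)
  qed measurable
  have summ: "summable (\<lambda>d. \<integral>u. norm (?f d u) \<partial>M)"
  proof (rule summableI_nonneg_bounded)
    fix n
    have "(\<Sum>d<n. \<integral>u. norm (?f d u) \<partial>M) = (\<integral>u. (\<Sum>d<n. norm (?f d u)) \<partial>M)"
      by (rule Bochner_Integration.integral_sum[symmetric]) (intro integrable_norm intf)
    also have "\<dots> \<le> (\<integral>u. norm (K u) * exp (norm (A u)) \<partial>M)"
      by (intro integral_mono Bochner_Integration.integrable_sum integrable_norm intf int' le)
    finally show "(\<Sum>d<n. \<integral>u. norm (?f d u) \<partial>M) \<le> (\<integral>u. norm (K u) * exp (norm (A u)) \<partial>M)" .
  qed simp
  have "(\<lambda>d. integral\<^sup>L M (?f d)) sums (\<integral>u. (\<Sum>d. ?f d u) \<partial>M)"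
    by (rule sums_integral[OF intf _ summ]) (use exps sums_summable in blast)
  moreover have "(\<Sum>d. ?f d u) = K u * exp (A u)" for u
    using sums_unique[OF sums_mult[OF exp_converges[of "A u"], of "K u"]]
    by simp
  moreover have "integral\<^sup>L M (?f d) = (\<integral>u. K u * A u ^ d \<partial>M) / fact d" for d
    by (simp add: scaleR_conv_of_real divide_inverse mult.commute)
  ultimately show "(\<lambda>d. (\<integral>u. K u * A u ^ d \<partial>M) / fact d) sums (\<integral>u. K u * exp (A u) \<partial>M)"
    by simp
  have "integrable M (\<lambda>u. (fact d :: real) *\<^sub>R ?f d u)"
    by (intro integrable_scaleR_right intf)
  then show "integrable M (\<lambda>u. K u * A u ^ d)" by simp
qed

lemma exp_integral_eq_0_if_moments_eq_0:
  fixes K A :: "'a \<Rightarrow> complex"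
  assumes "K \<in> borel_measurable M" "A \<in> borel_measurable M"
    and "integrable M (\<lambda>u. exp (norm (A u)) *\<^sub>R K u)"
    and "\<And>d. (\<integral>u. K u * A u ^ d \<partial>M) = 0"
  shows "(\<integral>u. K u * exp (A u) \<partial>M) = 0"
  using exp_integral_sums_moments(1)[OF assms(1-3)] assms(4) by (simp add: sums_iff)

lemma powser_real_eq_0_imp_coeff_eq_0:
  fixes a :: "nat \<Rightarrow> real"
  assumes "\<epsilon> > 0" "\<And>t. \<bar>t\<bar> < \<epsilon> \<Longrightarrow> (\<lambda>n. a n * t ^ n) sums 0"
  shows "a n = 0"
proof (induction n rule: less_induct)
  case (less n)
  have "((\<lambda>_::real. 0) \<longlongrightarrow> a (0 + n)) (at 0)"
  proof (rule powser_limit_0_strong[where a = "\<lambda>k. a (k + n)", OF assms(1)])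
    fix t :: real assume t: "t \<noteq> 0" "norm t < \<epsilon>"
    have "(\<lambda>k. a (k + n) * t ^ (k + n)) sums 0"
      using sums_split_initial_segment[OF assms(2)[of t], of n] t less.IH by simp
    from sums_mult2[OF this, of "inverse (t ^ n)"]
    show "(\<lambda>k. a (k + n) * t ^ k) sums 0"
      using t by (simp add: power_add field_simps)
  qed
  then show "a n = 0" using LIM_unique[OF _ tendsto_const] by fastforce
qed

text \<open>
  As a function of \<open>t\<close> the exponential integral is a power series with the moments as coefficients.
  Two choices of \<open>A\<close> matter: linear forms, and \<open>A u = \<bar>u\<bar>\<^sup>2\<close>. In the second case \<open>K\<close> contains a Gaussian
  and the moments are, up to sign, the derivatives with respect to the parameter of that Gaussian;
  the series replaces differentiation under the integral sign.
\<close>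
lemma moments_eq_0_if_exp_integral_eq_0:
  fixes K A :: "'a \<Rightarrow> complex"
  assumes [measurable]: "K \<in> borel_measurable M" "A \<in> borel_measurable M"
    and "\<epsilon> > 0" and int: "integrable M (\<lambda>u. exp (\<epsilon> * norm (A u)) *\<^sub>R K u)"
    and zero: "\<And>t. \<bar>t\<bar> < \<epsilon> \<Longrightarrow> (\<integral>u. K u * exp (of_real t * A u) \<partial>M) = 0"
  shows "(\<integral>u. K u * A u ^ d \<partial>M) = 0"
proof -
  let ?m = "\<lambda>d. (\<integral>u. K u * A u ^ d \<partial>M) / fact d"
  have S: "(\<lambda>d. ?m d * of_real t ^ d) sums 0" if t: "\<bar>t\<bar> < \<epsilon>" for t
  proof -
    have "integrable M (\<lambda>u. exp (norm (of_real t * A u)) *\<^sub>R K u)"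
    proof (rule Bochner_Integration.integrable_bound[OF int])
      have "exp (\<bar>t\<bar> * norm (A u)) * norm (K u) \<le> exp (\<epsilon> * norm (A u)) * norm (K u)" for u
        using t by (intro mult_right_mono) (auto intro: mult_right_mono)
      then show "AE u in M. norm (exp (norm (of_real t * A u)) *\<^sub>R K u) \<le>
          norm (exp (\<epsilon> * norm (A u)) *\<^sub>R K u)"
        by (simp add: norm_mult)
    qed measurable
    from exp_integral_sums_moments(1)[OF _ _ this] zero[OF t]
    have "(\<lambda>d. (\<integral>u. K u * (of_real t * A u) ^ d \<partial>M) / fact d) sums 0" by simp
    moreover have "(\<integral>u. K u * (of_real t * A u) ^ d \<partial>M) = (\<integral>u. K u * A u ^ d \<partial>M) * of_real t ^ d" for d
    proof -
      have "(\<integral>u. K u * (of_real t * A u) ^ d \<partial>M) = (\<integral>u. of_real t ^ d * (K u * A u ^ d) \<partial>M)"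
        by (simp add: power_mult_distrib mult_ac)
      then show ?thesis by (simp add: mult.commute del: of_real_power)
    qed
    ultimately show ?thesis by simp
  qed
  have "Re (?m d) = 0"
  proof (rule powser_real_eq_0_imp_coeff_eq_0[OF assms(3)])
    fix t :: real assume "\<bar>t\<bar> < \<epsilon>"
    have "Re (?m d * of_real t ^ d) = Re (?m d) * t ^ d" for d
      by (simp del: times_divide_eq_left flip: of_real_power)
    then show "(\<lambda>d. Re (?m d) * t ^ d) sums 0"
      using sums_Re[OF S[OF \<open>\<bar>t\<bar> < \<epsilon>\<close>]] by simp
  qed
  moreover have "Im (?m d) = 0"
  proof (rule powser_real_eq_0_imp_coeff_eq_0[OF assms(3)])
    fix t :: real assume "\<bar>t\<bar> < \<epsilon>"
    have "Im (?m d * of_real t ^ d) = Im (?m d) * t ^ d" for d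
      by (simp del: times_divide_eq_left flip: of_real_power)
    then show "(\<lambda>d. Im (?m d) * t ^ d) sums 0"
      using sums_Im[OF S[OF \<open>\<bar>t\<bar> < \<epsilon>\<close>]] by simp
  qed
  ultimately have "?m d = 0" by (simp add: complex_eq_iff)
  then show ?thesis by simp
qed

section \<open>Gaussian integrals determine a function\<close>

lemma
  fixes g :: "'a::euclidean_space \<Rightarrow> 'b::{banach, second_countable_topology}"
  assumes c: "c \<noteq> 0"
  shows integrable_lborel_affine: "integrable lborel g \<Longrightarrow> integrable lborel (\<lambda>x. g (t + c *\<^sub>R x))"
    and integral_lborel_affine:
      "g \<in> borel_measurable borel \<Longrightarrow>
        integral\<^sup>L lborel g = \<bar>c\<bar> ^ DIM('a) *\<^sub>R (\<integral>x. g (t + c *\<^sub>R x) \<partial>lborel)"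
proof -
  assume "integrable lborel g"
  moreover from this have [measurable]: "g \<in> borel_measurable borel" by auto
  ultimately have "integrable (density (distr lborel borel (\<lambda>x::'a. t + c *\<^sub>R x)) (\<lambda>_. \<bar>c\<bar> ^ DIM('a))) g"
    using lborel_affine[OF c, of t] by simp
  then have "integrable lborel (\<lambda>x. \<bar>c\<bar> ^ DIM('a) *\<^sub>R g (t + c *\<^sub>R x))"
    by (subst (asm) integrable_density) (auto simp: integrable_distr_eq)
  from integrable_scaleR_right[OF this, of "inverse (\<bar>c\<bar> ^ DIM('a))"] c
  show "integrable lborel (\<lambda>x. g (t + c *\<^sub>R x))" by simp
next
  assume [measurable]: "g \<in> borel_measurable borel"
  have "integral\<^sup>L lborel g =
    integral\<^sup>L (density (distr lborel borel (\<lambda>x::'a. t + c *\<^sub>R x)) (\<lambda>_. ennreal (\<bar>c\<bar> ^ DIM('a)))) g"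
    using lborel_affine[OF c, of t] by simp
  also have "\<dots> = (\<integral>x. \<bar>c\<bar> ^ DIM('a) *\<^sub>R g x \<partial>distr lborel borel (\<lambda>x::'a. t + c *\<^sub>R x))"
    by (subst integral_density) auto
  also have "\<dots> = \<bar>c\<bar> ^ DIM('a) *\<^sub>R (\<integral>x. g (t + c *\<^sub>R x) \<partial>lborel)"
    by (subst integral_distr) auto
  finally show "integral\<^sup>L lborel g = \<bar>c\<bar> ^ DIM('a) *\<^sub>R (\<integral>x. g (t + c *\<^sub>R x) \<partial>lborel)" .
qed

lemma integrable_lborel_product_bound:
  fixes F :: "'a::euclidean_space \<Rightarrow> 'b::euclidean_space \<Rightarrow> 'c::{banach, second_countable_topology}"
  assumes [measurable]: "case_prod F \<in> borel_measurable (lborel \<Otimes>\<^sub>M lborel)"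
    and g: "integrable lborel (g :: 'a \<Rightarrow> real)" and h: "integrable lborel (h :: 'b \<Rightarrow> real)"
    and le: "\<And>u v. norm (F u v) \<le> g u * h v"
  shows "integrable (lborel \<Otimes>\<^sub>M lborel) (case_prod F)"
proof (rule Bochner_Integration.integrable_bound)
  have [measurable]: "g \<in> borel_measurable borel" "h \<in> borel_measurable borel" using g h by auto
  show "integrable (lborel \<Otimes>\<^sub>M lborel) (\<lambda>(u, v). g u * h v)"
  proof (rule lborel_pair.Fubini_integrable)
    have "integrable lborel (\<lambda>u. norm (g u) * (\<integral>v. norm (h v) \<partial>lborel))"
      using g by (intro integrable_mult_left integrable_norm)
    then show "integrable lborel (\<lambda>u. \<integral>v. norm (case (u, v) of (u, v) \<Rightarrow> g u * h v) \<partial>lborel)"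
      by (simp add: abs_mult)
    show "AE u in lborel. integrable lborel (\<lambda>v. case (u, v) of (u, v) \<Rightarrow> g u * h v)"
      using h by (auto intro!: AE_I2)
  qed measurable
  show "AE x in lborel \<Otimes>\<^sub>M lborel. norm (case x of (u, v) \<Rightarrow> F u v) \<le> norm (case x of (u, v) \<Rightarrow> g u * h v)"
    using order_trans[OF le abs_ge_self] by (auto intro!: AE_I2)
qed fact

text \<open>
  The sets over which \<open>H\<close> integrates to \<open>0\<close> form a Dynkin system, and the boxes are an
  intersection-stable generator of the Borel sets.
\<close>
lemma AE_eq_0_if_box_integrals_eq_0:
  fixes H :: "'a::euclidean_space \<Rightarrow> complex"
  assumes H: "integrable lborel H"
    and box0: "\<And>l u. (\<integral>x. indicator (box l u) x *\<^sub>R H x \<partial>lborel) = 0"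
  shows "AE x in lborel. H x = 0"
proof (rule sigma_finite_measure.density_zero[OF sigma_finite_lborel H])
  let ?E = "range (\<lambda>(a, b). box a b::'a set)"
  let ?A = "\<lambda>n::nat. box (- (real n *\<^sub>R One)) (real n *\<^sub>R One) :: 'a set"
  have meas: "A \<in> sets lborel \<longleftrightarrow> A \<in> sigma_sets UNIV ?E" for A
    by (simp add: borel_eq_box)
  have int: "integrable lborel (\<lambda>x. indicator A x *\<^sub>R H x)" if "A \<in> sets lborel" for A
    using that H by (intro integrable_mult_indicator)
  have "(\<lambda>n. \<integral>x. indicator (?A n) x *\<^sub>R H x \<partial>lborel) \<longlonglongrightarrow> integral\<^sup>L lborel H"
  proof (rule integral_dominated_convergence)
    show "AE x in lborel. (\<lambda>n. indicator (?A n) x *\<^sub>R H x) \<longlonglongrightarrow> H x"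
    proof (rule AE_I2)
      fix x :: 'a
      obtain n0 where n0: "x \<in> ?A n0" using UN_box_eq_UNIV by blast
      have "x \<in> ?A n" if "n \<ge> n0" for n
      proof -
        have "real n0 \<le> real n" using that by simp
        then show ?thesis using n0 unfolding mem_box
          by (auto simp: inner_minus_left intro: order_le_less_trans[of "- real n" "- real n0"] order_less_le_trans[of _ "real n0" "real n"])
      qed
      then have "eventually (\<lambda>n. indicator (?A n) x *\<^sub>R H x = H x) sequentially"
        by (auto simp: eventually_sequentially intro!: exI[of _ n0])
      then show "(\<lambda>n. indicator (?A n) x *\<^sub>R H x) \<longlonglongrightarrow> H x" by (rule tendsto_eventually)
    qed
    show "integrable lborel (\<lambda>x. norm (H x))" using H by simp
  qed (use H in \<open>auto simp: indicator_def\<close>)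
  then have UNIV0: "integral\<^sup>L lborel H = 0" by (simp add: box0 LIMSEQ_const_iff)
  show "set_lebesgue_integral lborel A H = 0" if "A \<in> sets lborel" for A
    unfolding set_lebesgue_integral_def
  proof (rule sigma_sets_induct_disjoint[of ?E UNIV A])
    show "A \<in> sigma_sets UNIV ?E" using that meas by blast
  next
    show "Int_stable ?E" by (auto simp: Int_stable_def box_Int_box)
    show "?E \<subseteq> Pow UNIV" by simp
  next
    fix A assume "A \<in> ?E"
    then show "(LINT x|lborel. indicator A x *\<^sub>R H x) = 0" using box0 by auto
  next
    show "(LINT x|lborel. indicator {} x *\<^sub>R H x) = 0" by simp
  next
    fix A assume A: "A \<in> sigma_sets UNIV ?E" "(LINT x|lborel. indicator A x *\<^sub>R H x) = 0"
    have "(LINT x|lborel. indicator (UNIV - A) x *\<^sub>R H x) =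
        (LINT x|lborel. H x - indicator A x *\<^sub>R H x)"
      by (intro Bochner_Integration.integral_cong) (auto simp: indicator_def)
    also have "\<dots> = 0" using A int[of A] H UNIV0 meas by simp
    finally show "(LINT x|lborel. indicator (UNIV - A) x *\<^sub>R H x) = 0" .
  next
    fix A :: "nat \<Rightarrow> 'a set"
    assume A: "disjoint_family A" "range A \<subseteq> sigma_sets UNIV ?E"
      "\<And>i. (LINT x|lborel. indicator (A i) x *\<^sub>R H x) = 0"
    have "set_lebesgue_integral lborel (\<Union>i. A i) H = (\<Sum>i. set_lebesgue_integral lborel (A i) H)"
    proof (rule lebesgue_integral_countable_add)
      have "(\<Union>i. A i) \<in> sets lborel" using A(2) meas by blast
      then show "set_integrable lborel (\<Union>i. A i) H"
        unfolding set_integrable_def by (rule int)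
    qed (use A(1,2) meas in \<open>auto simp: disjoint_family_on_def\<close>)
    then show "(LINT x|lborel. indicator (\<Union>i. A i) x *\<^sub>R H x) = 0"
      using A(3) by (simp add: set_lebesgue_integral_def)
  qed
qed

lemma AE_lborel_notin_cbox_diff_box:
  "AE x in lborel. x \<notin> cbox l u - box (l::'a::euclidean_space) u"
proof -
  have "negligible (cbox l u - box l u)"
    using negligible_frontier_interval by blast
  then have "AE x in lebesgue. x \<notin> cbox l u - box l u"
    unfolding negligible_iff_null_sets by (rule AE_not_in)
  then show ?thesis by (simp add: AE_completion_iff)
qed

text \<open>
  Integrating the hypothesis over \<open>x\<close> in a box and exchanging the integrals shows that \<open>H\<close> integrates
  to \<open>0\<close> against the Gaussian regularizations of the indicator of the box. These are bounded and
  converge to a multiple of the indicator off the boundary of the box, which is a null set.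
\<close>
lemma AE_eq_0_if_gaussian_convolutions_eq_0:
  fixes H :: "'a::euclidean_space \<Rightarrow> complex"
  assumes H: "integrable lborel H"
    and conv: "\<And>a x. a > 0 \<Longrightarrow> (\<integral>u. H u * gaussian a (u - x) \<partial>lborel) = 0"
  shows "AE u in lborel. H u = 0"
proof (rule AE_eq_0_if_box_integrals_eq_0[OF H])
  fix l r :: 'a
  let ?B = "box l r"
  let ?g = "\<lambda>v::'a. exp (- (norm v)\<^sup>2)"
  define G where "G = (\<integral>v. ?g v \<partial>lborel)"
  define \<Phi> where "\<Phi> n u = (\<integral>v. indicator ?B (u + inverse (real (Suc n)) *\<^sub>R v) *\<^sub>R ?g v \<partial>lborel)" for n u
  have [measurable]: "H \<in> borel_measurable borel" using H by auto
  have intg: "integrable lborel ?g" using integrable_gaussian[of 1] by simp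
  have "G \<noteq> 0"
  proof
    assume "G = 0"
    then have "AE v in lborel. ?g v = 0"
      unfolding G_def using intg by (subst (asm) integral_nonneg_eq_0_iff_AE) auto
    then have "ae_filter (lborel :: 'a measure) = bot" by (simp add: eventually_False)
    then show False by (simp add: ae_filter_eq_bot_iff)
  qed
  have \<Phi>_meas [measurable]: "\<Phi> n \<in> borel_measurable borel" for n
    unfolding \<Phi>_def by measurable
  have int\<Phi>: "integrable lborel (\<lambda>v. indicator ?B (u + s *\<^sub>R v) *\<^sub>R ?g v)" for u s
    by (rule Bochner_Integration.integrable_bound[OF intg]) (auto simp: indicator_def)
  have \<Phi>_le: "norm (\<Phi> n u) \<le> G" for n u
    unfolding \<Phi>_def G_def real_norm_def
    by (rule integral_abs_bound_integral[OF int\<Phi> intg]) (auto simp: indicator_def)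
  have zero: "(\<integral>u. \<Phi> n u *\<^sub>R H u \<partial>lborel) = 0" for n
  proof -
    define c where "c = inverse (real (Suc n))"
    \<comment> \<open>The substitution \<open>x = u + c v\<close> turns the Gaussian with parameter \<open>a = 1 / c\<^sup>2\<close> into the one with parameter \<open>1\<close>.\<close>
    define a where "a = (real (Suc n))\<^sup>2"
    have c: "c \<noteq> 0" and a: "a > 0" by (auto simp: c_def a_def)
    let ?F = "\<lambda>u x. indicator ?B x *\<^sub>R (H u * gaussian a (u - x))"
    have sub: "(\<integral>x. ?F u x \<partial>lborel) = (c ^ DIM('a) * \<Phi> n u) *\<^sub>R H u" for u
    proof -
      have "(\<integral>x. ?F u x \<partial>lborel) = \<bar>c\<bar> ^ DIM('a) *\<^sub>R (\<integral>v. ?F u (u + c *\<^sub>R v) \<partial>lborel)"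
        by (rule integral_lborel_affine[OF c]) measurable
      also have "(\<integral>v. ?F u (u + c *\<^sub>R v) \<partial>lborel) =
          (\<integral>v. (indicator ?B (u + c *\<^sub>R v) *\<^sub>R ?g v) *\<^sub>R H u \<partial>lborel)"
      proof (intro Bochner_Integration.integral_cong refl)
        fix v :: 'a
        have "a * (c * norm v)\<^sup>2 = (norm v)\<^sup>2"
          by (simp add: a_def c_def power_mult_distrib power_inverse)
        then show "?F u (u + c *\<^sub>R v) = (indicator ?B (u + c *\<^sub>R v) *\<^sub>R ?g v) *\<^sub>R H u"
          by (simp add: scaleR_conv_of_real power_mult_distrib indicator_def)
      qed
      also have "\<dots> = \<Phi> n u *\<^sub>R H u"
        unfolding \<Phi>_def c_def by (rule Bochner_Integration.integral_scaleR_left) (rule int\<Phi>)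
      finally show ?thesis by (simp add: c_def)
    qed
    have int: "integrable (lborel \<Otimes>\<^sub>M lborel) (\<lambda>(u, x). ?F u x)"
    proof (rule integrable_lborel_product_bound)
      show "integrable lborel (\<lambda>u. norm (H u))" using H by simp
      show "integrable lborel (indicator ?B :: 'a \<Rightarrow> real)"
        by (rule integrable_real_indicator) (auto simp: emeasure_lborel_box_eq)
      fix u x :: 'a
      have "norm (H u) * exp (- a * (norm (u - x))\<^sup>2) \<le> norm (H u) * 1"
        using a by (intro mult_left_mono) auto
      then show "norm (?F u x) \<le> norm (H u) * indicator ?B x"
        by (simp add: norm_mult indicator_def)
    qed measurable
    have "(\<integral>u. (c ^ DIM('a) * \<Phi> n u) *\<^sub>R H u \<partial>lborel) = (\<integral>u. (\<integral>x. ?F u x \<partial>lborel) \<partial>lborel)"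
      by (simp only: sub)
    also have "\<dots> = (\<integral>x. (\<integral>u. ?F u x \<partial>lborel) \<partial>lborel)"
      using lborel_pair.Fubini_integral[OF int] by simp
    also have "\<dots> = 0" using conv[OF a] by simp
    finally have "c ^ DIM('a) *\<^sub>R (\<integral>u. \<Phi> n u *\<^sub>R H u \<partial>lborel) = 0"
      by (simp flip: scaleR_scaleR)
    then show ?thesis using c by simp
  qed
  have lim: "(\<lambda>n. \<integral>u. \<Phi> n u *\<^sub>R H u \<partial>lborel) \<longlonglongrightarrow> (\<integral>u. (G * indicator ?B u) *\<^sub>R H u \<partial>lborel)"
  proof (rule integral_dominated_convergence)
    show "integrable lborel (\<lambda>u. G * norm (H u))" using H by simp
    show "AE u in lborel. norm (\<Phi> n u *\<^sub>R H u) \<le> G * norm (H u)" for n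
      using \<Phi>_le by (auto intro!: AE_I2 mult_right_mono)
    show "AE u in lborel. (\<lambda>n. \<Phi> n u *\<^sub>R H u) \<longlonglongrightarrow> (G * indicator ?B u) *\<^sub>R H u"
      using AE_lborel_notin_cbox_diff_box[of l r]
    proof eventually_elim
      case (elim u)
      have "(\<lambda>n. \<Phi> n u) \<longlonglongrightarrow> (\<integral>v. indicator ?B u *\<^sub>R ?g v \<partial>lborel)"
        unfolding \<Phi>_def
      proof (rule integral_dominated_convergence[OF _ _ intg])
        show "AE v in lborel. (\<lambda>n. indicator ?B (u + inverse (real (Suc n)) *\<^sub>R v) *\<^sub>R ?g v)
            \<longlonglongrightarrow> indicator ?B u *\<^sub>R ?g v"
        proof (rule AE_I2)
          fix v :: 'a
          have "(\<lambda>n. u + inverse (real (Suc n)) *\<^sub>R v) \<longlonglongrightarrow> u + 0 *\<^sub>R v"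
            by (intro tendsto_intros LIMSEQ_inverse_real_of_nat)
          then have L: "(\<lambda>n. u + inverse (real (Suc n)) *\<^sub>R v) \<longlonglongrightarrow> u" by simp
          have "eventually (\<lambda>n. indicator ?B (u + inverse (real (Suc n)) *\<^sub>R v) = (indicator ?B u :: real)) sequentially"
          proof (cases "u \<in> ?B")
            case True
            then show ?thesis using topological_tendstoD[OF L open_box True]
              by (auto elim!: eventually_mono)
          next
            case False
            then have "u \<in> - cbox l r" using elim by auto
            from topological_tendstoD[OF L _ this]
            have "eventually (\<lambda>n. u + inverse (real (Suc n)) *\<^sub>R v \<in> - cbox l r) sequentially"
              by (simp add: closed_cbox open_Compl)
            then show ?thesis using False box_subset_cbox[of l r]
              by (auto elim!: eventually_mono simp: indicator_def)
          qed
          then show "(\<lambda>n. indicator ?B (u + inverse (real (Suc n)) *\<^sub>R v) *\<^sub>R ?g v)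
            \<longlonglongrightarrow> indicator ?B u *\<^sub>R ?g v"
            by (intro tendsto_eventually) (auto elim!: eventually_mono)
        qed
      qed (auto simp: indicator_def)
      then have "(\<lambda>n. \<Phi> n u) \<longlonglongrightarrow> G * indicator ?B u"
        by (simp add: G_def mult.commute)
      then show ?case by (intro tendsto_intros)
    qed
  qed measurable
  then have "(\<integral>u. (G * indicator ?B u) *\<^sub>R H u \<partial>lborel) = 0"
    by (simp add: zero LIMSEQ_const_iff)
  then have "G *\<^sub>R (\<integral>u. indicator ?B u *\<^sub>R H u \<partial>lborel) = 0"
    by (simp flip: scaleR_scaleR)
  then show "(\<integral>u. indicator ?B u *\<^sub>R H u \<partial>lborel) = 0" using \<open>G \<noteq> 0\<close> by simp
qed

lemma gaussian_diff:
  "gaussian a (u - x) = gaussian a u * exp (of_real (2 * a * (u \<bullet> x))) * gaussian a x"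
proof -
  have "- a * (norm (u - x))\<^sup>2 = - a * (norm u)\<^sup>2 + 2 * a * (u \<bullet> x) + - a * (norm x)\<^sup>2"
    unfolding power2_norm_eq_inner by (simp add: inner_diff inner_commute algebra_simps)
  then have "exp (- a * (norm (u - x))\<^sup>2) =
      exp (- a * (norm u)\<^sup>2) * exp (2 * a * (u \<bullet> x)) * exp (- a * (norm x)\<^sup>2)"
    by (simp only: exp_add)
  then show ?thesis by (simp only: of_real_mult flip: exp_of_real)
qed

lemma AE_eq_0_if_gaussian_exp_integrals_eq_0:
  fixes H :: "'a::euclidean_space \<Rightarrow> complex"
  assumes H: "integrable lborel H"
    and zero: "\<And>a y. a > 0 \<Longrightarrow> (\<integral>u. H u * gaussian a u * exp (of_real (u \<bullet> y)) \<partial>lborel) = 0"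
  shows "AE u in lborel. H u = 0"
proof (rule AE_eq_0_if_gaussian_convolutions_eq_0[OF H])
  fix a :: real and x :: 'a
  assume a: "a > 0"
  have "(\<integral>u. H u * gaussian a (u - x) \<partial>lborel) =
      (\<integral>u. (H u * gaussian a u * exp (of_real (u \<bullet> (2 * a) *\<^sub>R x))) * gaussian a x \<partial>lborel)"
    by (simp only: gaussian_diff inner_scaleR_right mult.assoc)
  also have "\<dots> = 0"
    using zero[OF a, of "(2 * a) *\<^sub>R x"] by (simp del: inner_scaleR_right of_real_exp)
  finally show "(\<integral>u. H u * gaussian a (u - x) \<partial>lborel) = 0" .
qed

section \<open>Polynomial functions and the mean value property\<close>

text \<open>
  Complex-valued real polynomials on a Euclidean space. The class is closed under directional
  derivatives, so all the smoothness needed below comes from membership in it.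
\<close>

inductive polyfun :: "('a::euclidean_space \<Rightarrow> complex) \<Rightarrow> bool" where
  linear: "bounded_linear h \<Longrightarrow> polyfun h"
| const: "polyfun (\<lambda>_. c)"
| add: "polyfun p \<Longrightarrow> polyfun q \<Longrightarrow> polyfun (\<lambda>z. p z + q z)"
| mult: "polyfun p \<Longrightarrow> polyfun q \<Longrightarrow> polyfun (\<lambda>z. p z * q z)"

lemmas polyfun_intros = polyfun.const polyfun.add polyfun.mult

lemma polyfun_power: "polyfun p \<Longrightarrow> polyfun (\<lambda>z. p z ^ n)"
  by (induction n) (auto intro: polyfun_intros)

lemma polyfun_sum: "(\<And>i. i \<in> I \<Longrightarrow> polyfun (p i)) \<Longrightarrow> polyfun (\<lambda>z. \<Sum>i\<in>I. p i z)"
  by (induction I rule: infinite_finite_induct) (auto intro: polyfun_intros)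

lemma polyfun_prod: "(\<And>i. i \<in> I \<Longrightarrow> polyfun (p i)) \<Longrightarrow> polyfun (\<lambda>z. \<Prod>i\<in>I. p i z)"
  by (induction I rule: infinite_finite_induct) (auto intro: polyfun_intros)

lemma polyfun_exp_growth: "polyfun p \<Longrightarrow> exp_growth p"
  by (induction rule: polyfun.induct) auto

lemma polyfun_affine:
  assumes "polyfun p" shows "polyfun (\<lambda>u. p (z + \<tau> *\<^sub>R u))"
  using assms
proof induction
  case (linear h)
  interpret bounded_linear h by fact
  have "polyfun (\<lambda>u. h z + of_real \<tau> * h u)"
    by (intro polyfun_intros polyfun.linear \<open>bounded_linear h\<close>)
  then show ?case by (simp add: add scaleR scaleR_conv_of_real)
qed (auto intro: polyfun_intros)

lemma polyfun_has_polyfun_derivative: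
  assumes "polyfun p"
  shows "\<exists>p'. (\<forall>z. (p has_derivative p' z) (at z)) \<and> (\<forall>b. polyfun (\<lambda>z. p' z b))"
  using assms
proof induction
  case (linear h)
  then show ?case
    by (intro exI[of _ "\<lambda>_. h"]) (auto intro: polyfun.const bounded_linear_imp_has_derivative)
next
  case (const c)
  then show ?case by (intro exI[of _ "\<lambda>_ _. 0"]) (auto intro: polyfun.const)
next
  case (add p q)
  then obtain p' q' where
    "\<And>z. (p has_derivative p' z) (at z)" "\<And>b. polyfun (\<lambda>z. p' z b)"
    "\<And>z. (q has_derivative q' z) (at z)" "\<And>b. polyfun (\<lambda>z. q' z b)" by blast
  then show ?case
    by (intro exI[of _ "\<lambda>z b. p' z b + q' z b"]) (auto intro: polyfun.add has_derivative_add)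
next
  case (mult p q)
  then obtain p' q' where
    "\<And>z. (p has_derivative p' z) (at z)" "\<And>b. polyfun (\<lambda>z. p' z b)"
    "\<And>z. (q has_derivative q' z) (at z)" "\<And>b. polyfun (\<lambda>z. q' z b)" by blast
  then show ?case
    by (intro exI[of _ "\<lambda>z b. p z * q' z b + p' z b * q z"] conjI allI polyfun_intros
        has_derivative_mult mult.hyps)
qed

lemma directional_deriv_eq:
  assumes "(p has_derivative p') (at z)"
  shows "directional_deriv b p z = p' b"
proof -
  have "((\<lambda>t. p (z + t *\<^sub>R b)) has_derivative (\<lambda>s. p' (s *\<^sub>R b))) (at 0)"
    by (rule has_derivative_compose[of "\<lambda>t. z + t *\<^sub>R b" "\<lambda>s. s *\<^sub>R b" 0 UNIV p p', simplified])
       (auto intro!: derivative_eq_intros assms)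
  moreover have "p' (s *\<^sub>R b) = s *\<^sub>R p' b" for s
    using has_derivative_linear[OF assms] by (simp add: linear_scale)
  ultimately have "((\<lambda>t. p (z + t *\<^sub>R b)) has_vector_derivative p' b) (at 0)"
    by (simp add: has_vector_derivative_def)
  then show ?thesis unfolding directional_deriv_def by (rule vector_derivative_at)
qed

lemma polyfun_has_derivative:
  assumes "polyfun p"
  shows "(p has_derivative (\<lambda>b. directional_deriv b p z)) (at z)"
  using polyfun_has_polyfun_derivative[OF assms] directional_deriv_eq[of p _ z]
  by (metis (no_types, lifting) ext)

lemma polyfun_directional_deriv:
  assumes "polyfun p" shows "polyfun (directional_deriv b p)"
proof -
  obtain p' where "\<And>z. (p has_derivative p' z) (at z)" "polyfun (\<lambda>z. p' z b)"
    using polyfun_has_polyfun_derivative[OF assms] by blast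
  moreover from this have "directional_deriv b p = (\<lambda>z. p' z b)"
    by (auto simp: directional_deriv_eq)
  ultimately show ?thesis by simp
qed

lemma polyfun_has_vector_derivative:
  assumes "polyfun p"
  shows "((\<lambda>t. p (z + t *\<^sub>R b)) has_vector_derivative directional_deriv b p (z + t *\<^sub>R b)) (at t)"
proof -
  let ?y = "z + t *\<^sub>R b"
  have D: "(p has_derivative (\<lambda>b. directional_deriv b p ?y)) (at ?y)"
    by (rule polyfun_has_derivative[OF assms])
  have "((\<lambda>t. p (z + t *\<^sub>R b)) has_derivative (\<lambda>s. directional_deriv (s *\<^sub>R b) p ?y)) (at t)"
    by (rule has_derivative_compose[of "\<lambda>t. z + t *\<^sub>R b" "\<lambda>s. s *\<^sub>R b" t UNIV p _, OF _ D])
       (auto intro!: derivative_eq_intros)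
  moreover have "directional_deriv (s *\<^sub>R b) p ?y = s *\<^sub>R directional_deriv b p ?y" for s
    using linear_scale[OF has_derivative_linear[OF D]] by simp
  ultimately show ?thesis by (simp add: has_vector_derivative_def)
qed

lemma polyfun_continuous_on: "polyfun p \<Longrightarrow> continuous_on S p"
  by (meson has_derivative_at_withinI has_derivative_continuous_on polyfun_has_derivative)

lemma polyfun_measurable [measurable_dest]: "polyfun p \<Longrightarrow> p \<in> borel_measurable borel"
  by (intro exp_growth_measurable polyfun_exp_growth)

lemma directional_deriv_decompose:
  assumes "polyfun p"
  shows "directional_deriv v p z = (\<Sum>e\<in>Basis. (v \<bullet> e) *\<^sub>R directional_deriv e p z)"
proof -
  have lin: "linear (\<lambda>b. directional_deriv b p z)"
    using polyfun_has_derivative[OF assms] by (rule has_derivative_linear)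
  have "directional_deriv v p z = directional_deriv (\<Sum>e\<in>Basis. (v \<bullet> e) *\<^sub>R e) p z"
    by (simp add: euclidean_representation)
  also have "\<dots> = (\<Sum>e\<in>Basis. (v \<bullet> e) *\<^sub>R directional_deriv e p z)"
    by (simp add: linear_sum[OF lin] linear_scale[OF lin])
  finally show ?thesis .
qed

lemma directional_deriv_linear_combination:
  assumes "\<And>i. i \<in> I \<Longrightarrow> polyfun (p i)"
  shows "directional_deriv b (\<lambda>z. \<Sum>i\<in>I. c i * p i z) = (\<lambda>z. \<Sum>i\<in>I. c i * directional_deriv b (p i) z)"
proof
  fix z
  have "((\<lambda>z. \<Sum>i\<in>I. c i * p i z) has_derivative
      (\<lambda>b. \<Sum>i\<in>I. c i * directional_deriv b (p i) z)) (at z)"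
    by (intro has_derivative_sum has_derivative_mult_right polyfun_has_derivative assms)
  then show "directional_deriv b (\<lambda>z. \<Sum>i\<in>I. c i * p i z) z = (\<Sum>i\<in>I. c i * directional_deriv b (p i) z)"
    by (rule directional_deriv_eq)
qed

lemma laplacian_linear_combination:
  assumes "\<And>i. i \<in> I \<Longrightarrow> polyfun (p i)"
  shows "laplacian (\<lambda>z. \<Sum>i\<in>I. c i * p i z) z = (\<Sum>i\<in>I. c i * laplacian (p i) z)"
proof -
  have "laplacian (\<lambda>z. \<Sum>i\<in>I. c i * p i z) z =
      (\<Sum>b\<in>Basis. \<Sum>i\<in>I. c i * directional_deriv b (directional_deriv b (p i)) z)"
    unfolding laplacian_def using assms
    by (simp add: directional_deriv_linear_combination polyfun_directional_deriv)
  also have "\<dots> = (\<Sum>i\<in>I. c i * laplacian (p i) z)"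
    unfolding laplacian_def sum_distrib_left by (rule sum.swap)
  finally show ?thesis .
qed

lemma directional_deriv_affine:
  assumes "polyfun p"
  shows "directional_deriv e (\<lambda>u. p (z + \<tau> *\<^sub>R u)) u = \<tau> *\<^sub>R directional_deriv e p (z + \<tau> *\<^sub>R u)"
proof -
  let ?y = "z + \<tau> *\<^sub>R u"
  have D: "(p has_derivative (\<lambda>b. directional_deriv b p ?y)) (at ?y)"
    by (rule polyfun_has_derivative[OF assms])
  have "((\<lambda>u. p (z + \<tau> *\<^sub>R u)) has_derivative (\<lambda>s. directional_deriv (\<tau> *\<^sub>R s) p ?y)) (at u)"
    by (rule has_derivative_compose[of "\<lambda>u. z + \<tau> *\<^sub>R u" "\<lambda>s. \<tau> *\<^sub>R s" u UNIV p _, OF _ D])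
       (auto intro!: derivative_eq_intros)
  then have "directional_deriv e (\<lambda>u. p (z + \<tau> *\<^sub>R u)) u = directional_deriv (\<tau> *\<^sub>R e) p ?y"
    by (rule directional_deriv_eq)
  then show ?thesis using linear_scale[OF has_derivative_linear[OF D]] by simp
qed

text \<open>
  Applying the fundamental theorem of calculus in \<open>t\<close> and then Fubini's theorem replaces
  differentiation under the integral sign.
\<close>
lemma integral_derivative_constant:
  fixes F F' :: "real \<Rightarrow> 'a::euclidean_space \<Rightarrow> complex"
  assumes deriv: "\<And>t u. ((\<lambda>t. F t u) has_vector_derivative F' t u) (at t)"
    and cont: "\<And>u. continuous_on UNIV (\<lambda>t. F' t u)"
    and meas [measurable]: "case_prod F' \<in> borel_measurable (lborel \<Otimes>\<^sub>M lborel)"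
    and g: "integrable lborel g" "\<And>t u. 0 \<le> t \<Longrightarrow> t \<le> 1 \<Longrightarrow> norm (F' t u) \<le> g u"
    and int: "integrable lborel (F 0)" "integrable lborel (F 1)"
    and c: "\<And>t. 0 \<le> t \<Longrightarrow> t \<le> 1 \<Longrightarrow> (\<integral>u. F' t u \<partial>lborel) = c"
  shows "(\<integral>u. F 1 u \<partial>lborel) - (\<integral>u. F 0 u \<partial>lborel) = c"
proof -
  let ?G = "\<lambda>t u. indicator {0..1} t *\<^sub>R F' t u"
  have "integrable (lborel \<Otimes>\<^sub>M lborel) (case_prod ?G)"
  proof (rule integrable_lborel_product_bound)
    show "integrable lborel (indicator {0..1::real} :: real \<Rightarrow> real)" by simp
    show "integrable lborel g" by (rule g)
    show "norm (?G t u) \<le> indicator {0..1} t * g u" for t u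
      using g(2)[of t u] by (auto simp: indicator_def)
  qed measurable
  from lborel_pair.Fubini_integral[OF this]
  have "(\<integral>u. (\<integral>t. ?G t u \<partial>lborel) \<partial>lborel) = (\<integral>t. (\<integral>u. ?G t u \<partial>lborel) \<partial>lborel)" .
  moreover have ftc: "(\<integral>t. ?G t u \<partial>lborel) = F 1 u - F 0 u" for u
    using cont by (intro integral_FTC_atLeastAtMost)
      (auto intro: has_vector_derivative_at_within deriv continuous_on_subset)
  moreover have inner: "(\<integral>u. ?G t u \<partial>lborel) = indicator {0..1} t *\<^sub>R c" for t
    using c[of t] by (auto simp: indicator_def)
  moreover have "(\<integral>t. indicator {0..1::real} t *\<^sub>R c \<partial>lborel) = c"
    by (subst Bochner_Integration.integral_scaleR_left)
       (auto intro!: integrable_real_indicator simp: measure_def)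
  ultimately have "(\<integral>u. F 1 u - F 0 u \<partial>lborel) = c" by (simp only: ftc inner)
  then show ?thesis using int by simp
qed

text \<open>
  By translation invariance, the integral of \<open>u \<mapsto> Q (u + t e) exp (- b \<bar>u + t e\<bar>\<^sup>2)\<close> does not depend
  on \<open>t\<close>, and neither does the integral of its \<open>t\<close>-derivative, which therefore vanishes.
\<close>
lemma gaussian_integration_by_parts:
  fixes Q :: "'a::euclidean_space \<Rightarrow> complex"
  assumes Q: "polyfun Q" and b: "b > 0" and e: "e \<in> Basis"
  shows "(\<integral>u. directional_deriv e Q u * gaussian b u \<partial>lborel) =
         2 * of_real b * (\<integral>u. of_real (u \<bullet> e) * Q u * gaussian b u \<partial>lborel)"
proof -
  \<comment> \<open>The derivative of \<open>Q u exp (- b \<bar>u\<bar>\<^sup>2)\<close> along \<open>e\<close> is \<open>q u exp (- b \<bar>u\<bar>\<^sup>2)\<close>.\<close>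
  define q where "q u = directional_deriv e Q u - 2 * of_real b * of_real (u \<bullet> e) * Q u" for u
  let ?F = "\<lambda>t u. Q (u + t *\<^sub>R e) * gaussian b (u + t *\<^sub>R e)"
  let ?F' = "\<lambda>t u. q (u + t *\<^sub>R e) * gaussian b (u + t *\<^sub>R e)"
  have pe: "polyfun (\<lambda>u. of_real (u \<bullet> e))"
    by (intro polyfun.linear bounded_linear_compose[OF bounded_linear_of_real]
        bounded_linear_inner_left)
  have Qe: "polyfun (\<lambda>u. of_real (u \<bullet> e) * Q u)" by (intro polyfun_intros pe Q)
  have "polyfun (\<lambda>u. directional_deriv e Q u + (- 2 * of_real b) * (of_real (u \<bullet> e) * Q u))"
    by (intro polyfun_intros Qe polyfun_directional_deriv Q pe)
  then have q: "polyfun q" by (simp add: q_def[abs_def] mult.assoc)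
  have [measurable]: "q \<in> borel_measurable borel" using q by measurable
  have int: "integrable lborel (\<lambda>u. p u * gaussian b u)" if "polyfun p" for p
    using that b by (intro exp_integrable_integrable exp_integrable_mult polyfun_exp_growth exp_integrable_gaussian)
  obtain C R where CR: "C \<ge> 0" "R \<ge> 0" "\<And>u. norm (q u) \<le> C * exp (R * norm u)"
    using exp_growthE[OF polyfun_exp_growth[OF q]] by blast
  have "(\<integral>u. ?F 1 u \<partial>lborel) - (\<integral>u. ?F 0 u \<partial>lborel) = (\<integral>u. q u * gaussian b u \<partial>lborel)"
  proof (rule integral_derivative_constant)
    fix t :: real and u :: 'a
    have sq: "(norm (u + t *\<^sub>R e))\<^sup>2 = (norm u)\<^sup>2 + 2 * t * (u \<bullet> e) + t\<^sup>2" for t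
      unfolding power2_norm_eq_inner using e
      by (simp add: inner_add inner_commute power2_eq_square inner_same_Basis)
    have "((\<lambda>t. exp (- b * (norm (u + t *\<^sub>R e))\<^sup>2)) has_vector_derivative
        - 2 * b * ((u + t *\<^sub>R e) \<bullet> e) * exp (- b * (norm (u + t *\<^sub>R e))\<^sup>2)) (at t)"
      unfolding sq using e
      by (auto intro!: derivative_eq_intros simp: inner_add inner_same_Basis algebra_simps
          simp flip: has_real_derivative_iff_has_vector_derivative)
    then have "((\<lambda>t. gaussian b (u + t *\<^sub>R e)) has_vector_derivative
        of_real (- 2 * b * ((u + t *\<^sub>R e) \<bullet> e) * exp (- b * (norm (u + t *\<^sub>R e))\<^sup>2))) (at t)"
      by (rule bounded_linear.has_vector_derivative[OF bounded_linear_of_real])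
    from has_vector_derivative_mult[OF polyfun_has_vector_derivative[OF Q] this]
    show "((\<lambda>t. ?F t u) has_vector_derivative ?F' t u) (at t)"
      by (rule has_vector_derivative_eq_rhs) (simp add: q_def algebra_simps)
  next
    fix u :: 'a
    show "continuous_on UNIV (\<lambda>t. ?F' t u)"
      by (intro continuous_intros continuous_on_compose2[OF polyfun_continuous_on[OF q, of UNIV]]) auto
  next
    show "(\<lambda>(t, u). ?F' t u) \<in> borel_measurable (lborel \<Otimes>\<^sub>M lborel)" by measurable
  next
    \<comment> \<open>For \<open>0 \<le> t \<le> 1\<close>, translation by \<open>t e\<close> costs at most a factor \<open>exp R\<close> in the bound for \<open>q\<close> and \<open>exp (2 b \<bar>u\<bar>)\<close> in the Gaussian.\<close>
    have "exp_integrable (\<lambda>u::'a. of_real (C * exp R) * gaussian b u)"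
      using b by (intro exp_integrable_mult exp_growth_const exp_integrable_gaussian)
    from this[unfolded exp_integrable_def]
    have "integrable lborel (\<lambda>u::'a. exp ((R + 2 * b) * norm u) *\<^sub>R (of_real (C * exp R) * gaussian b u))"
      by blast
    from integrable_norm[OF this]
    show "integrable lborel (\<lambda>u::'a. C * exp R * (exp ((R + 2 * b) * norm u) * exp (- b * (norm u)\<^sup>2)))"
      using CR(1) by (simp add: norm_mult mult_ac)
  next
    fix t :: real and u :: 'a assume t: "0 \<le> t" "t \<le> 1"
    have ne: "norm e = 1" using e by simp
    have "norm (u + t *\<^sub>R e) \<le> norm u + 1"
      using norm_triangle_ineq[of u "t *\<^sub>R e"] t ne by simp
    then have "exp (R * norm (u + t *\<^sub>R e)) \<le> exp (R * (norm u + 1))"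
      using CR(2) by (auto intro: mult_left_mono)
    then have q_le: "norm (q (u + t *\<^sub>R e)) \<le> C * exp (R * (norm u + 1))"
      using CR(3)[of "u + t *\<^sub>R e"] CR(1) by (meson mult_left_mono order_trans)
    have "\<bar>t * (u \<bullet> e)\<bar> \<le> 1 * norm u"
      unfolding abs_mult using t Cauchy_Schwarz_ineq2[of u e] ne by (intro mult_mono) auto
    moreover have "(norm (u + t *\<^sub>R e))\<^sup>2 = (norm u)\<^sup>2 + 2 * (t * (u \<bullet> e)) + t\<^sup>2"
      unfolding power2_norm_eq_inner using ne
      by (simp add: inner_add inner_commute power2_eq_square norm_eq_1)
    ultimately have "(norm (u + t *\<^sub>R e))\<^sup>2 \<ge> (norm u)\<^sup>2 - 2 * norm u"
      using zero_le_power2[of t] by linarith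
    then have "b * ((norm u)\<^sup>2 - 2 * norm u) \<le> b * (norm (u + t *\<^sub>R e))\<^sup>2"
      using b by (intro mult_left_mono) auto
    then have g_le: "exp (- b * (norm (u + t *\<^sub>R e))\<^sup>2) \<le> exp (2 * b * norm u + - b * (norm u)\<^sup>2)"
      by (simp add: algebra_simps)
    have "norm (?F' t u) \<le> (C * exp (R * (norm u + 1))) * exp (2 * b * norm u + - b * (norm u)\<^sup>2)"
      unfolding norm_mult norm_of_real abs_exp_cancel
      using q_le g_le CR(1) by (intro mult_mono) auto
    also have "\<dots> = C * exp R * (exp ((R + 2 * b) * norm u) * exp (- b * (norm u)\<^sup>2))"
      by (simp only: exp_add distrib_left distrib_right mult_1_right mult_1_left mult_ac)
    finally show "norm (?F' t u) \<le> C * exp R * (exp ((R + 2 * b) * norm u) * exp (- b * (norm u)\<^sup>2))" .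
  next
    show "integrable lborel (?F 0)" "integrable lborel (?F 1)"
      using int[OF Q] integrable_lborel_affine[of 1 "\<lambda>u. Q u * gaussian b u" e] by (auto simp: add.commute)
  next
    fix t :: real
    show "(\<integral>u. ?F' t u \<partial>lborel) = (\<integral>u. q u * gaussian b u \<partial>lborel)"
      using integral_lborel_affine[of 1 "\<lambda>u. q u * gaussian b u" "t *\<^sub>R e"] by (simp add: add.commute)
  qed
  moreover have "(\<integral>u. ?F 1 u \<partial>lborel) = (\<integral>u. ?F 0 u \<partial>lborel)"
    using Q integral_lborel_affine[of 1 "\<lambda>u. Q u * gaussian b u" e] by (simp add: add.commute)
  ultimately have "0 = (\<integral>u. q u * gaussian b u \<partial>lborel)" by simp
  also have "\<dots> = (\<integral>u. directional_deriv e Q u * gaussian b u - 2 * of_real b * (of_real (u \<bullet> e) * Q u * gaussian b u) \<partial>lborel)"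
    by (simp add: q_def algebra_simps)
  also have "\<dots> = (\<integral>u. directional_deriv e Q u * gaussian b u \<partial>lborel) -
      2 * of_real b * (\<integral>u. of_real (u \<bullet> e) * Q u * gaussian b u \<partial>lborel)"
    using int[OF polyfun_directional_deriv[OF Q]] int[OF Qe]
    by (subst Bochner_Integration.integral_diff) auto
  finally show ?thesis by simp
qed

text \<open>
  The integral of \<open>P (z + t u)\<close> against the Gaussian in \<open>u\<close> has the \<open>t\<close>-derivative
  \<open>\<Sum>e\<in>Basis. \<integral>u. (u \<bullet> e) D\<^sub>e P (z + t u)\<close> (with the same weight). Integration by parts turns the factor \<open>u \<bullet> e\<close>
  into \<open>t / (2 b)\<close> times another derivative along \<open>e\<close>, and the sum becomes the Laplacian. So the value
  at \<open>t = 1\<close> is the value at \<open>t = 0\<close>.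
\<close>
lemma gaussian_mean_value:
  fixes P :: "'a::euclidean_space \<Rightarrow> complex"
  assumes P: "polyfun P" and harm: "\<And>z. laplacian P z = 0" and b: "b > 0"
  shows "(\<integral>u. P (z + u) * gaussian b u \<partial>lborel) = P z * (\<integral>u. gaussian b (u::'a) \<partial>lborel)"
proof -
  let ?F = "\<lambda>t u. P (z + t *\<^sub>R u) * gaussian b u"
  let ?D = "\<lambda>e. directional_deriv e P"
  let ?F' = "\<lambda>t u. (\<Sum>e\<in>Basis. of_real (u \<bullet> e) * ?D e (z + t *\<^sub>R u) * gaussian b u)"
  have [measurable]: "?D e \<in> borel_measurable borel" for e
    using polyfun_directional_deriv[OF P] by measurable
  have pe: "polyfun (\<lambda>u. of_real (u \<bullet> e))" for e :: 'a
    by (intro polyfun.linear bounded_linear_compose[OF bounded_linear_of_real]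
        bounded_linear_inner_left)
  have int: "integrable lborel (\<lambda>u. p u * gaussian b u)" if "polyfun p" for p
    using that b by (intro exp_integrable_integrable exp_integrable_mult polyfun_exp_growth exp_integrable_gaussian)
  have "\<exists>C R. C \<ge> 0 \<and> R \<ge> 0 \<and> (\<forall>u. norm (?D e u) \<le> C * exp (R * norm u))" for e
    using exp_growthE[OF polyfun_exp_growth[OF polyfun_directional_deriv[OF P]]] by metis
  then obtain C R where CR: "\<And>e. C e \<ge> 0" "\<And>e. R e \<ge> 0"
    "\<And>e u. norm (?D e u) \<le> C e * exp (R e * norm u)" by metis
  let ?g = "\<lambda>u::'a. \<Sum>e\<in>Basis. C e * exp (R e * norm z) * (exp ((1 + R e) * norm u) * exp (- b * (norm u)\<^sup>2))"
  have "(\<integral>u. ?F 1 u \<partial>lborel) - (\<integral>u. ?F 0 u \<partial>lborel) = 0"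
  proof (rule integral_derivative_constant)
    fix t :: real and u :: 'a
    have "((\<lambda>t. P (z + t *\<^sub>R u)) has_vector_derivative ?D u (z + t *\<^sub>R u)) (at t)"
      by (rule polyfun_has_vector_derivative[OF P])
    from has_vector_derivative_mult[OF this has_vector_derivative_const[of "gaussian b u"]]
    show "((\<lambda>t. ?F t u) has_vector_derivative ?F' t u) (at t)"
      by (rule has_vector_derivative_eq_rhs)
         (simp add: directional_deriv_decompose[OF P, of u] scaleR_conv_of_real sum_distrib_right)
  next
    fix u :: 'a
    show "continuous_on UNIV (\<lambda>t. ?F' t u)"
      by (intro continuous_intros
          continuous_on_compose2[OF polyfun_continuous_on[OF polyfun_directional_deriv[OF P], of UNIV]]) auto
  next
    show "(\<lambda>(t, u). ?F' t u) \<in> borel_measurable (lborel \<Otimes>\<^sub>M lborel)" by measurable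
  next
    have "integrable lborel (\<lambda>u::'a. exp (S * norm u) * exp (- b * (norm u)\<^sup>2))" for S
    proof -
      have "integrable lborel (\<lambda>u::'a. exp (S * norm u) *\<^sub>R gaussian b u)"
        using exp_integrable_gaussian[OF b, where 'a = 'a] unfolding exp_integrable_def by blast
      from integrable_norm[OF this] show ?thesis by (simp add: norm_mult)
    qed
    then show "integrable lborel ?g"
      by (intro Bochner_Integration.integrable_sum integrable_mult_right)
  next
    fix t :: real and u :: 'a assume t: "0 \<le> t" "t \<le> 1"
    have tu: "norm (z + t *\<^sub>R u) \<le> norm z + norm u"
      using norm_triangle_ineq[of z "t *\<^sub>R u"] t mult_right_mono[of t 1 "norm u"] by simp
    have "norm (of_real (u \<bullet> e) * ?D e (z + t *\<^sub>R u) * gaussian b u) \<le>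
        C e * exp (R e * norm z) * (exp ((1 + R e) * norm u) * exp (- b * (norm u)\<^sup>2))"
      if e: "e \<in> Basis" for e
    proof -
      have "\<bar>u \<bullet> e\<bar> \<le> exp (norm u)"
        using Cauchy_Schwarz_ineq2[of u e] e exp_ge_add_one_self[of "norm u"]
        by (simp add: order_trans[of _ "norm u"] del: exp_ge_add_one_self)
      moreover have "norm (?D e (z + t *\<^sub>R u)) \<le> C e * exp (R e * (norm z + norm u))"
        using CR(3)[of e "z + t *\<^sub>R u"] CR(1)[of e] mult_left_mono[OF tu CR(2)[of e]]
        by (meson exp_le_cancel_iff mult_left_mono order_trans)
      ultimately have "norm (of_real (u \<bullet> e) * ?D e (z + t *\<^sub>R u) * gaussian b u) \<le>
          exp (norm u) * (C e * exp (R e * (norm z + norm u))) * exp (- b * (norm u)\<^sup>2)"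
        unfolding norm_mult norm_of_real abs_exp_cancel
        using CR(1) by (intro mult_mono mult_right_mono) auto
      then show ?thesis by (simp add: exp_add distrib_left distrib_right mult_ac)
    qed
    then show "norm (?F' t u) \<le> ?g u" by (rule sum_norm_le)
  next
    show "integrable lborel (?F 0)" "integrable lborel (?F 1)"
      using int[OF polyfun_affine[OF P, of z 0]] int[OF polyfun_affine[OF P, of z 1]] by auto
  next
    fix t :: real
    have inte: "integrable lborel (\<lambda>u. of_real (u \<bullet> e) * ?D e (z + t *\<^sub>R u) * gaussian b u)" for e
      by (intro int polyfun_intros pe polyfun_affine polyfun_directional_deriv P)
    have parts: "2 * of_real b * (\<integral>u. of_real (u \<bullet> e) * ?D e (z + t *\<^sub>R u) * gaussian b u \<partial>lborel) =
        of_real t * (\<integral>u. directional_deriv e (?D e) (z + t *\<^sub>R u) * gaussian b u \<partial>lborel)"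
      if e: "e \<in> Basis" for e
      using gaussian_integration_by_parts[OF polyfun_affine[OF polyfun_directional_deriv[OF P, of e], of z t] b e]
      by (simp add: directional_deriv_affine[OF polyfun_directional_deriv[OF P]] scaleR_conv_of_real mult.assoc)
    have "2 * of_real b * (\<integral>u. ?F' t u \<partial>lborel) =
        (\<Sum>e\<in>Basis. 2 * of_real b * (\<integral>u. of_real (u \<bullet> e) * ?D e (z + t *\<^sub>R u) * gaussian b u \<partial>lborel))"
      by (subst Bochner_Integration.integral_sum[OF inte]) (simp add: sum_distrib_left)
    also have "\<dots> = of_real t * (\<Sum>e\<in>Basis. \<integral>u. directional_deriv e (?D e) (z + t *\<^sub>R u) * gaussian b u \<partial>lborel)"
      unfolding sum_distrib_left by (rule sum.cong[OF refl parts])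
    also have "(\<Sum>e\<in>Basis. \<integral>u. directional_deriv e (?D e) (z + t *\<^sub>R u) * gaussian b u \<partial>lborel) =
        (\<integral>u. laplacian P (z + t *\<^sub>R u) * gaussian b u \<partial>lborel)"
      unfolding laplacian_def sum_distrib_right
      by (intro Bochner_Integration.integral_sum[symmetric] int polyfun_affine polyfun_directional_deriv P)
    finally show "(\<integral>u. ?F' t u \<partial>lborel) = 0" using harm b by simp
  qed
  then show ?thesis by simp
qed

section \<open>Mixed moments along a complex direction\<close>

definition hprod :: "complex ^ 'n \<Rightarrow> complex ^ 'n \<Rightarrow> complex" where
  "hprod u z = (\<Sum>j\<in>UNIV. u $ j * cnj (z $ j))"

lemma cnj_hprod: "cnj (hprod u z) = hprod z u"
  by (simp add: hprod_def mult.commute)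

lemma hprod_smult_left: "hprod (c *s u) z = c * hprod u z"
  and hprod_smult_right: "hprod u (c *s z) = cnj c * hprod u z"
  by (simp_all add: hprod_def sum_distrib_left mult_ac)

lemma hprod_add_left: "hprod (u + v) z = hprod u z + hprod v z"
  and hprod_add_right: "hprod z (u + v) = hprod z u + hprod z v"
  by (simp_all add: hprod_def algebra_simps sum.distrib)

lemma hprod_scaleR_left: "hprod (r *\<^sub>R u) z = r *\<^sub>R hprod u z"
  and hprod_scaleR_right: "hprod u (r *\<^sub>R z) = r *\<^sub>R hprod u z"
  by (simp_all add: hprod_def scaleR_sum_right)

lemma bounded_linear_hprod_left: "bounded_linear (\<lambda>u. hprod u z)"
  and bounded_linear_hprod_right: "bounded_linear (\<lambda>u. hprod z u)"
  by (auto intro!: linear_conv_bounded_linear[THEN iffD1] linearI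
      simp: hprod_add_left hprod_add_right hprod_scaleR_left hprod_scaleR_right)

lemma Re_hprod: "Re (hprod u z) = u \<bullet> z"
  by (simp add: hprod_def inner_vec_def inner_complex_def)

lemma hprod_add_hprod: "hprod u z + hprod z u = of_real (2 * (u \<bullet> z))"
  using complex_add_cnj[of "hprod u z"] by (simp add: cnj_hprod Re_hprod)

lemma hprod_self: "hprod u u = of_real ((norm u)\<^sup>2)"
  using hprod_add_hprod[of u u] by (simp add: power2_norm_eq_inner)

lemma polyfun_hprod_left: "polyfun (\<lambda>u. hprod u z)"
  and polyfun_hprod_right: "polyfun (\<lambda>u. hprod z u)"
  by (intro polyfun.linear bounded_linear_hprod_left bounded_linear_hprod_right)+

text \<open>
  The index \<open>p\<close> is the degree in \<open>z\<close> and \<open>q\<close> the degree in the conjugate of \<open>z\<close>, the order in which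
  bidegrees are listed for \<open>bihomogeneous_poly\<close>.
\<close>
definition mixed_moment ::
    "(complex ^ 'n \<Rightarrow> complex) \<Rightarrow> nat \<Rightarrow> nat \<Rightarrow> complex ^ 'n \<Rightarrow> complex" where
  "mixed_moment K p q z = (\<integral>u. K u * (hprod u z ^ q * hprod z u ^ p) \<partial>lborel)"

lemma exp_growth_exp_linear:
  assumes "bounded_linear (h :: 'a::euclidean_space \<Rightarrow> complex)"
  shows "exp_growth (\<lambda>u. of_real (exp (norm (h u))))"
proof -
  obtain M where M: "\<And>x. norm (h x) \<le> norm x * M" "M > 0"
    using bounded_linear.pos_bounded[OF assms] by blast
  have [measurable]: "h \<in> borel_measurable borel"
    using assms by (intro borel_measurable_continuous_onI linear_continuous_on)
  show ?thesis
    by (rule exp_growthI[where C = 1 and R = M]) (use M(1) in \<open>auto simp: mult.commute\<close>)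
qed

lemma exp_integrable_exp_norm_linear:
  assumes "exp_integrable K" "bounded_linear (h :: 'a::euclidean_space \<Rightarrow> complex)"
  shows "integrable lborel (\<lambda>u. exp (norm (h u)) *\<^sub>R K u)"
  using exp_integrable_integrable[OF exp_integrable_mult[OF exp_growth_exp_linear[OF assms(2)] assms(1)]]
  by (simp add: scaleR_conv_of_real)

lemma exp_integrable_exp_linear:
  assumes K: "exp_integrable K" and h: "bounded_linear (h :: 'a::euclidean_space \<Rightarrow> complex)"
  shows "integrable lborel (\<lambda>u. K u * exp (h u))"
proof (rule Bochner_Integration.integrable_bound[OF exp_integrable_exp_norm_linear[OF K h]])
  have "(\<lambda>u. exp (h u)) \<in> borel_measurable borel"
    using linear_continuous_on[OF h] by (intro borel_measurable_continuous_onI continuous_intros)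
  then show "(\<lambda>u. K u * exp (h u)) \<in> borel_measurable lborel" using K by measurable
  show "AE u in lborel. norm (K u * exp (h u)) \<le> norm (exp (norm (h u)) *\<^sub>R K u)"
    by (auto simp: norm_mult mult.commute complex_Re_le_cmod intro!: AE_I2 mult_left_mono)
qed

lemma mixed_moment_integrable:
  assumes "exp_integrable K"
  shows "integrable lborel (\<lambda>u. K u * (hprod u z ^ q * hprod z u ^ p))"
proof -
  have "exp_integrable (\<lambda>u. (hprod u z ^ q * hprod z u ^ p) * K u)"
    using assms by (intro exp_integrable_mult polyfun_exp_growth polyfun_intros polyfun_power
        polyfun_hprod_left polyfun_hprod_right)
  from exp_integrable_integrable[OF this] show ?thesis by (simp add: mult.commute)
qed

lemma bounded_linear_hprod_combination:
  "bounded_linear (\<lambda>u. \<alpha> * hprod u z + \<beta> * hprod z u)"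
  by (intro bounded_linear_add bounded_linear_const_mult bounded_linear_hprod_left
      bounded_linear_hprod_right)

lemma integral_hprod_combination_power:
  assumes "exp_integrable K"
  shows "(\<integral>u. K u * (\<alpha> * hprod u z + \<beta> * hprod z u) ^ d \<partial>lborel) =
    (\<Sum>k\<le>d. of_nat (d choose k) * \<alpha> ^ k * \<beta> ^ (d - k) * mixed_moment K (d - k) k z)"
proof -
  have "(\<integral>u. K u * (\<alpha> * hprod u z + \<beta> * hprod z u) ^ d \<partial>lborel) =
    (\<integral>u. (\<Sum>k\<le>d. (of_nat (d choose k) * \<alpha> ^ k * \<beta> ^ (d - k)) * (K u * (hprod u z ^ k * hprod z u ^ (d - k)))) \<partial>lborel)"
    by (simp add: binomial_ring power_mult_distrib sum_distrib_left mult_ac)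
  also have "\<dots> = (\<Sum>k\<le>d. of_nat (d choose k) * \<alpha> ^ k * \<beta> ^ (d - k) * mixed_moment K (d - k) k z)"
    unfolding mixed_moment_def
    by (subst Bochner_Integration.integral_sum)
       (auto intro!: integrable_mult_right mixed_moment_integrable assms)
  finally show ?thesis .
qed

lemma exp_integral_eq_0_if_mixed_moments_eq_0:
  assumes K: "exp_integrable K" and "\<And>p q. mixed_moment K p q z = 0"
  shows "(\<integral>u. K u * exp (\<alpha> * hprod u z + \<beta> * hprod z u) \<partial>lborel) = 0"
proof (rule exp_integral_eq_0_if_moments_eq_0)
  let ?A = "\<lambda>u. \<alpha> * hprod u z + \<beta> * hprod z u"
  show "?A \<in> borel_measurable lborel"
    using linear_continuous_on[OF bounded_linear_hprod_combination, of UNIV \<alpha> z \<beta>]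
    by (simp add: borel_measurable_continuous_onI)
  show "integrable lborel (\<lambda>u. exp (norm (?A u)) *\<^sub>R K u)"
    by (rule exp_integrable_exp_norm_linear[OF K bounded_linear_hprod_combination])
  show "(\<integral>u. K u * ?A u ^ d \<partial>lborel) = 0" for d
    using assms by (simp add: integral_hprod_combination_power)
qed (use K in measurable)

text \<open>
  Along a complex line the exponential integral is a power series in \<open>\<lambda>\<close> and its conjugate
  whose coefficients are multiples of the mixed moments. Restricting to \<open>\<lambda> = t\<omega>\<close> with real \<open>t\<close>
  separates the total degrees, and the unimodular \<open>\<omega>\<close> then separate the bidegrees.
\<close>

lemma mixed_moments_eq_0_if_exp_integral_eq_0:
  assumes K: "exp_integrable K" and "\<alpha> \<noteq> 0" "\<beta> \<noteq> 0"
    and zero: "\<And>c. (\<integral>u. K u * exp (\<alpha> * hprod u (c *s z) + \<beta> * hprod (c *s z) u) \<partial>lborel) = 0"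
  shows "mixed_moment K p q z = 0"
proof -
  define d where "d = p + q"
  define a where "a k = of_nat (d choose k) * \<alpha> ^ k * \<beta> ^ (d - k) * mixed_moment K (d - k) k z" for k
  have circle: "(\<Sum>k\<le>d. a k * x ^ k) = 0" if "norm x = 1" for x
  proof -
    \<comment> \<open>The \<open>k\<close>-th term carries the factor \<open>cnj w ^ k * w ^ (d - k)\<close>, which is \<open>cnj w ^ (2 * k)\<close> up to the common factor \<open>w ^ d\<close>; hence the choice of \<open>cnj w\<close> as a square root of \<open>x\<close>.\<close>
    define w where "w = cnj (csqrt x)"
    have "norm w = 1" by (simp add: w_def norm_csqrt that)
    then have "cnj w * w = 1"
      using complex_norm_square[of w] by (simp add: mult.commute)
    have "(cnj w)\<^sup>2 = x" by (simp add: w_def)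
    let ?A = "\<lambda>u. (\<alpha> * cnj w) * hprod u z + (\<beta> * w) * hprod z u"
    have "(\<integral>u. K u * ?A u ^ d \<partial>lborel) = 0"
    proof (rule moments_eq_0_if_exp_integral_eq_0[where \<epsilon> = 1])
      show "?A \<in> borel_measurable lborel"
        using linear_continuous_on[OF bounded_linear_hprod_combination, of UNIV "\<alpha> * cnj w" z "\<beta> * w"]
        by (simp add: borel_measurable_continuous_onI)
      show "integrable lborel (\<lambda>u. exp (1 * norm (?A u)) *\<^sub>R K u)"
        using exp_integrable_exp_norm_linear[OF K bounded_linear_hprod_combination] by simp
      fix t :: real
      show "(\<integral>u. K u * exp (of_real t * ?A u) \<partial>lborel) = 0"
        using zero[of "of_real t * w"]
        by (simp add: hprod_smult_left hprod_smult_right algebra_simps)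
    qed (use K in measurable)
    then have "0 = (\<Sum>k\<le>d. of_nat (d choose k) * (\<alpha> * cnj w) ^ k * (\<beta> * w) ^ (d - k) * mixed_moment K (d - k) k z) * cnj w ^ d"
      by (simp add: integral_hprod_combination_power[OF K])
    also have "\<dots> = (\<Sum>k\<le>d. a k * x ^ k)"
      unfolding sum_distrib_right
    proof (rule sum.cong[OF refl])
      fix k assume "k \<in> {..d}"
      then have "cnj w ^ d = cnj w ^ k * cnj w ^ (d - k)" by (simp flip: power_add)
      then have "cnj w ^ k * w ^ (d - k) * cnj w ^ d = (cnj w ^ k * cnj w ^ k) * (cnj w * w) ^ (d - k)"
        by (simp add: power_mult_distrib mult_ac)
      also have "\<dots> = x ^ k"
        using \<open>(cnj w)\<^sup>2 = x\<close> \<open>cnj w * w = 1\<close> by (simp flip: power_mult_distrib add: power2_eq_square)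
      finally have "cnj w ^ k * w ^ (d - k) * cnj w ^ d = x ^ k" .
      then show "of_nat (d choose k) * (\<alpha> * cnj w) ^ k * (\<beta> * w) ^ (d - k) * mixed_moment K (d - k) k z * cnj w ^ d =
          a k * x ^ k"
        by (simp add: a_def power_mult_distrib mult_ac)
    qed
    finally show ?thesis by simp
  qed
  \<comment> \<open>The polynomial with coefficients \<open>a\<close> vanishes on the unit circle, so it has infinitely many roots.\<close>
  have "infinite {x::complex. norm x = 1}"
  proof
    assume "finite {x::complex. norm x = 1}"
    moreover have "cis ` {0..1} \<subseteq> {x. norm x = 1}" by auto
    moreover have "inj_on cis {0..1}"
    proof (rule inj_onI)
      fix s t :: real assume st: "s \<in> {0..1}" "t \<in> {0..1}" "cis s = cis t"
      then have "cos s = cos t" by (metis cis.sel(1))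
      then show "s = t" using st cos_inj_pi[of s t] pi_gt3 by auto
    qed
    ultimately have "finite {0..1::real}" by (meson finite_imageD finite_subset)
    then show False by (simp add: infinite_Icc)
  qed
  then have "infinite {x. (\<Sum>k\<le>d. a k * x ^ k) = 0}"
    using circle by (metis (mono_tags, lifting) finite_subset mem_Collect_eq subsetI)
  then have "a q = 0"
    using polyfun_finite_roots[of a d] by (simp add: d_def)
  then show ?thesis using assms(2,3) by (simp add: a_def d_def)
qed

section \<open>Harmonicity of the mixed moments\<close>

lemma sum_Basis_complex_vec:
  "(\<Sum>b\<in>(Basis :: (complex ^ 'n) set). f b) = (\<Sum>j\<in>UNIV. f (axis j 1) + f (axis j \<i>))"
proof -
  have "(Basis :: (complex ^ 'n) set) = (\<Union>j\<in>UNIV. {axis j 1, axis j \<i>})"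
    by (auto simp: Basis_vec_def Basis_complex_def)
  moreover have union: "sum f (\<Union>j\<in>UNIV. {axis j 1, axis j \<i>}) = (\<Sum>j\<in>UNIV. \<Sum>b\<in>{axis j 1, axis j \<i>}. f b)"
    by (rule sum.UNION_disjoint) (auto simp: axis_eq_axis)
  ultimately have "(\<Sum>b\<in>(Basis :: (complex ^ 'n) set). f b) = (\<Sum>j\<in>UNIV. \<Sum>b\<in>{axis j 1, axis j \<i>}. f b)"
    using union by simp
  then show ?thesis by (simp add: axis_eq_axis)
qed

lemma hprod_axis_left: "hprod (axis j c) u = c * cnj (u $ j)"
  and hprod_axis_right: "hprod u (axis j c) = u $ j * cnj c"
  by (simp_all add: hprod_def axis_def if_distrib if_distribR cong: if_cong)

lemma directional_deriv_linear_powers: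
  fixes A B :: "'a::real_normed_vector \<Rightarrow> complex"
  assumes A: "bounded_linear A" and B: "bounded_linear B"
  shows "directional_deriv b (\<lambda>z. A z ^ q * B z ^ p) =
    (\<lambda>z. of_nat q * A b * (A z ^ (q - 1) * B z ^ p) + of_nat p * B b * (A z ^ q * B z ^ (p - 1)))"
proof
  fix z
  have "((\<lambda>z. A z ^ q * B z ^ p) has_derivative
      (\<lambda>b. A z ^ q * (of_nat p * B b * B z ^ (p - 1)) + of_nat q * A b * A z ^ (q - 1) * B z ^ p)) (at z)"
    by (intro has_derivative_mult has_derivative_power bounded_linear_imp_has_derivative A B)
  from directional_deriv_eq[OF this, of b]
  show "directional_deriv b (\<lambda>z. A z ^ q * B z ^ p) z =
      of_nat q * A b * (A z ^ (q - 1) * B z ^ p) + of_nat p * B b * (A z ^ q * B z ^ (p - 1))"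
    by (simp add: mult_ac)
qed

text \<open>
  Terms that differentiate the same factor twice contain the sums over the basis of \<open>(hprod u b)\<^sup>2\<close> or of
  \<open>(hprod b u)\<^sup>2\<close>; these vanish because the directions \<open>axis j 1\<close> and \<open>axis j \<i>\<close> contribute opposite
  numbers. Only the mixed terms survive.
\<close>
lemma laplacian_hprod_powers:
  "laplacian (\<lambda>z. hprod u z ^ q * hprod z u ^ p) z =
    4 * of_nat p * of_nat q * of_real ((norm u)\<^sup>2) * (hprod u z ^ (q - 1) * hprod z u ^ (p - 1))"
proof -
  let ?k = "\<lambda>q p z. hprod u z ^ q * hprod z u ^ p"
  have poly: "polyfun (?k q p)" for q p
    by (intro polyfun_intros polyfun_power polyfun_hprod_left polyfun_hprod_right)
  have d1: "directional_deriv b (?k q p) =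
      (\<lambda>z. of_nat q * hprod u b * ?k (q - 1) p z + of_nat p * hprod b u * ?k q (p - 1) z)" for b q p
    by (rule directional_deriv_linear_powers[OF bounded_linear_hprod_right bounded_linear_hprod_left])
  have d2: "directional_deriv b (directional_deriv b (?k q p)) z =
      (hprod u b)\<^sup>2 * (of_nat q * of_nat (q - 1) * ?k (q - 1 - 1) p z) +
      (hprod b u)\<^sup>2 * (of_nat p * of_nat (p - 1) * ?k q (p - 1 - 1) z) +
      (hprod u b * hprod b u) * (2 * of_nat p * of_nat q * ?k (q - 1) (p - 1) z)" for b
  proof -
    \<comment> \<open>The first derivative has two terms; a sum over \<open>{False, True}\<close> brings it into the form of a linear combination.\<close>
    have "directional_deriv b (\<lambda>z. \<Sum>i\<in>{False, True}.
          (if i then of_nat q * hprod u b else of_nat p * hprod b u) * (if i then ?k (q - 1) p else ?k q (p - 1)) z)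
      = (\<lambda>z. \<Sum>i\<in>{False, True}. (if i then of_nat q * hprod u b else of_nat p * hprod b u) *
           directional_deriv b (if i then ?k (q - 1) p else ?k q (p - 1)) z)"
      by (rule directional_deriv_linear_combination) (auto simp: poly)
    then have "directional_deriv b (directional_deriv b (?k q p)) z =
        of_nat q * hprod u b * directional_deriv b (?k (q - 1) p) z +
        of_nat p * hprod b u * directional_deriv b (?k q (p - 1)) z"
      unfolding d1[of b q p] by (simp add: add.commute)
    then show ?thesis unfolding d1 by (simp add: algebra_simps power2_eq_square)
  qed
  have sq: "(\<Sum>b\<in>Basis. (hprod u b)\<^sup>2) = 0" "(\<Sum>b\<in>Basis. (hprod b u)\<^sup>2) = 0"
    by (simp_all add: sum_Basis_complex_vec hprod_axis_left hprod_axis_right power_mult_distrib)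
  have i2: "x * \<i> * (\<i> * y) = - (x * y)" for x y
    by (simp add: mult.assoc[symmetric]) (simp add: mult.assoc)
  have "(\<Sum>b\<in>Basis. hprod u b * hprod b u) = 2 * hprod u u"
    by (simp add: i2 sum_Basis_complex_vec hprod_axis_left hprod_axis_right hprod_def[of u u] sum_distrib_left)
  then have cross: "(\<Sum>b\<in>Basis. hprod u b * hprod b u) = 2 * of_real ((norm u)\<^sup>2)"
    by (simp only: hprod_self)
  show ?thesis
    unfolding laplacian_def d2 sum.distrib sum_distrib_right[symmetric] sq cross by simp
qed

text \<open>
  Only the shape of the expansion is used below, so the multinomial coefficients stay
  existentially quantified and the induction need not identify them.
\<close>
lemma multinomial_expansion:
  "\<exists>m. \<forall>x::'n::finite \<Rightarrow> 'b::comm_ring_1.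
     (\<Sum>j\<in>UNIV. x j) ^ d = (\<Sum>\<alpha>\<in>multi_indices d. m \<alpha> * (\<Prod>j\<in>UNIV. x j ^ \<alpha> j))"
proof (induction d)
  case 0
  have "(multi_indices 0 :: ('n \<Rightarrow> nat) set) = {\<lambda>_. 0}"
    by (auto simp: multi_indices_def)
  then show ?case by (intro exI[of _ "\<lambda>_. 1"]) simp
next
  case (Suc d)
  then obtain m where m: "\<And>x::'n \<Rightarrow> 'b. (\<Sum>j\<in>UNIV. x j) ^ d = (\<Sum>\<alpha>\<in>multi_indices d. m \<alpha> * (\<Prod>j\<in>UNIV. x j ^ \<alpha> j))"
    by blast
  let ?up = "\<lambda>(i, \<alpha>). \<alpha>(i := Suc (\<alpha> i)) :: 'n \<Rightarrow> nat"
  let ?D = "UNIV \<times> multi_indices d :: ('n \<times> ('n \<Rightarrow> nat)) set"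
  let ?m' = "\<lambda>\<gamma>. \<Sum>p\<in>{p \<in> ?D. ?up p = \<gamma>}. m (snd p)"
  have fin: "finite ?D" by (simp add: finite_multi_indices)
  have up: "?up ` ?D \<subseteq> multi_indices (Suc d)"
  proof safe
    fix i and \<alpha> :: "'n \<Rightarrow> nat" assume "\<alpha> \<in> multi_indices d"
    then show "\<alpha>(i := Suc (\<alpha> i)) \<in> multi_indices (Suc d)"
      by (simp add: multi_indices_def sum.remove[of UNIV i])
  qed
  show ?case
  proof (intro exI[of _ ?m'] allI)
    fix x :: "'n \<Rightarrow> 'b"
    have "(\<Sum>j\<in>UNIV. x j) ^ Suc d = (\<Sum>i\<in>UNIV. \<Sum>\<alpha>\<in>multi_indices d. x i * (m \<alpha> * (\<Prod>j\<in>UNIV. x j ^ \<alpha> j)))"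
      by (simp add: m sum_product)
    also have "\<dots> = (\<Sum>p\<in>?D. m (snd p) * (\<Prod>j\<in>UNIV. x j ^ ?up p j))"
      unfolding sum.cartesian_product
    proof (rule sum.cong[OF refl], clarify)
      fix i and \<alpha> :: "'n \<Rightarrow> nat"
      have "(\<Prod>j\<in>UNIV. x j ^ (\<alpha>(i := Suc (\<alpha> i))) j) = x i * (\<Prod>j\<in>UNIV. x j ^ \<alpha> j)"
        by (simp add: prod.remove[of UNIV i] mult_ac)
      then show "x i * (m \<alpha> * (\<Prod>j\<in>UNIV. x j ^ \<alpha> j)) =
          m (snd (i, \<alpha>)) * (\<Prod>j\<in>UNIV. x j ^ ((\<alpha>(i := Suc (\<alpha> i))) j))"
        by (simp add: mult_ac)
    qed
    also have "\<dots> = (\<Sum>\<gamma>\<in>multi_indices (Suc d). \<Sum>p\<in>{p \<in> ?D. ?up p = \<gamma>}. m (snd p) * (\<Prod>j\<in>UNIV. x j ^ ?up p j))"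
      by (rule sum.group[OF fin finite_multi_indices up, symmetric])
    also have "\<dots> = (\<Sum>\<gamma>\<in>multi_indices (Suc d). ?m' \<gamma> * (\<Prod>j\<in>UNIV. x j ^ \<gamma> j))"
      by (auto simp: sum_distrib_right intro!: sum.cong)
    finally show "(\<Sum>j\<in>UNIV. x j) ^ Suc d = (\<Sum>\<gamma>\<in>multi_indices (Suc d). ?m' \<gamma> * (\<Prod>j\<in>UNIV. x j ^ \<gamma> j))" .
  qed
qed

lemma polyfun_monomial:
  "polyfun (\<lambda>z. (\<Prod>j\<in>UNIV. (z $ j) ^ \<alpha> j) * (\<Prod>j\<in>UNIV. cnj (z $ j) ^ \<beta> j))"
proof -
  have "bounded_linear (\<lambda>z::complex ^ 'n. z $ j)" for j
    by (rule bounded_linear_vec_nth)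
  moreover from this have "bounded_linear (\<lambda>z::complex ^ 'n. cnj (z $ j))" for j
    by (rule bounded_linear_compose[OF bounded_linear_cnj])
  ultimately show ?thesis
    by (intro polyfun_intros polyfun_prod polyfun_power polyfun.linear)
qed

lemma bihomogeneous_poly_eq_sum:
  "bihomogeneous_poly s t c z = (\<Sum>(\<alpha>, \<beta>)\<in>multi_indices s \<times> multi_indices t.
     c \<alpha> \<beta> * ((\<Prod>j\<in>UNIV. (z $ j) ^ \<alpha> j) * (\<Prod>j\<in>UNIV. cnj (z $ j) ^ \<beta> j)))"
  unfolding bihomogeneous_poly_def sum.cartesian_product by (simp add: mult.assoc)

lemma polyfun_bihomogeneous_poly: "polyfun (bihomogeneous_poly s t c)"
proof -
  have "polyfun (\<lambda>z. \<Sum>(\<alpha>, \<beta>)\<in>multi_indices s \<times> multi_indices t.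
     c \<alpha> \<beta> * ((\<Prod>j\<in>UNIV. (z $ j) ^ \<alpha> j) * (\<Prod>j\<in>UNIV. cnj (z $ j) ^ \<beta> j)))"
    by (intro polyfun_sum) (auto intro!: polyfun.mult[OF polyfun.const] polyfun_monomial split: prod.splits)
  then show ?thesis by (simp add: bihomogeneous_poly_eq_sum[abs_def])
qed

lemma bihomogeneous_poly_smult:
  "bihomogeneous_poly s t c (a *s z) = a ^ s * cnj a ^ t * bihomogeneous_poly s t c z"
proof -
  have "(\<Prod>j\<in>UNIV. (a * z $ j) ^ \<alpha> j) = a ^ d * (\<Prod>j\<in>UNIV. (z $ j) ^ \<alpha> j)"
    if "\<alpha> \<in> multi_indices d" for a d and \<alpha> :: "'a \<Rightarrow> nat" and z :: "complex ^ 'a"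
    using that by (simp add: power_mult_distrib prod.distrib multi_indices_def flip: power_sum)
  from this this[of _ _ "cnj a" "\<chi> j. cnj (z $ j)"] show ?thesis
    unfolding bihomogeneous_poly_def sum_distrib_left
    by (intro sum.cong refl) (simp add: mult_ac)
qed

text \<open>
  The kernel is a polynomial in \<open>z\<close> with coefficients depending on \<open>u\<close>, so integrating against \<open>K\<close>
  and differentiating in \<open>z\<close> are exchanged by finite linear algebra.
\<close>

lemma mixed_moment_laplacian:
  fixes K :: "complex ^ 'n \<Rightarrow> complex"
  assumes K: "exp_integrable K"
  shows "\<exists>c. mixed_moment K p q = bihomogeneous_poly p q c"
    and "laplacian (mixed_moment K p q) z =
      4 * of_nat p * of_nat q * mixed_moment (\<lambda>u. of_real ((norm u)\<^sup>2) * K u) (p - 1) (q - 1) z"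
proof -
  obtain m where m: "\<And>x::'n \<Rightarrow> complex. (\<Sum>j\<in>UNIV. x j) ^ p = (\<Sum>\<alpha>\<in>multi_indices p. m \<alpha> * (\<Prod>j\<in>UNIV. x j ^ \<alpha> j))"
    using multinomial_expansion[of p] by blast
  obtain m' where m': "\<And>x::'n \<Rightarrow> complex. (\<Sum>j\<in>UNIV. x j) ^ q = (\<Sum>\<beta>\<in>multi_indices q. m' \<beta> * (\<Prod>j\<in>UNIV. x j ^ \<beta> j))"
    using multinomial_expansion[of q] by blast
  let ?I = "multi_indices p \<times> multi_indices q :: (('n \<Rightarrow> nat) \<times> ('n \<Rightarrow> nat)) set"
  define M where "M i z = (\<Prod>j\<in>UNIV. (z $ j) ^ fst i j) * (\<Prod>j\<in>UNIV. cnj (z $ j) ^ snd i j)"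
    for i :: "('n \<Rightarrow> nat) \<times> ('n \<Rightarrow> nat)" and z :: "complex ^ 'n"
  define a where "a i = m (fst i) * m' (snd i)" for i
  have M: "polyfun (M i)" for i unfolding M_def by (rule polyfun_monomial)
  have kernel: "hprod u z ^ q * hprod z u ^ p = (\<Sum>i\<in>?I. (a i * M (snd i, fst i) u) * M i z)" for u z
  proof -
    have "hprod u z ^ q * hprod z u ^ p =
        (\<Sum>\<alpha>\<in>multi_indices p. m \<alpha> * (\<Prod>j\<in>UNIV. (z $ j * cnj (u $ j)) ^ \<alpha> j)) *
        (\<Sum>\<beta>\<in>multi_indices q. m' \<beta> * (\<Prod>j\<in>UNIV. (u $ j * cnj (z $ j)) ^ \<beta> j))"
      by (simp add: hprod_def m m' mult.commute)
    then show ?thesis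
      unfolding sum_product sum.cartesian_product
      by (simp add: a_def M_def power_mult_distrib prod.distrib mult_ac case_prod_beta')
  qed
  have intM: "integrable lborel (\<lambda>u. M i u * K u)" for i
    using K by (intro exp_integrable_integrable exp_integrable_mult polyfun_exp_growth M)
  define c where "c i = a i * (\<integral>u. M (snd i, fst i) u * K u \<partial>lborel)" for i
  have swap: "(\<integral>u. K u * (\<Sum>i\<in>?I. (a i * M (snd i, fst i) u) * g i) \<partial>lborel) = (\<Sum>i\<in>?I. c i * g i)" for g
  proof -
    have "(\<integral>u. K u * (\<Sum>i\<in>?I. (a i * M (snd i, fst i) u) * g i) \<partial>lborel) =
        (\<integral>u. (\<Sum>i\<in>?I. (a i * g i) * (M (snd i, fst i) u * K u)) \<partial>lborel)"
      by (simp add: sum_distrib_left mult_ac)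
    also have "\<dots> = (\<Sum>i\<in>?I. (a i * g i) * (\<integral>u. M (snd i, fst i) u * K u \<partial>lborel))"
      by (subst Bochner_Integration.integral_sum) (auto intro!: integrable_mult_right intM)
    finally show ?thesis by (simp add: c_def mult_ac)
  qed
  have eq: "mixed_moment K p q = (\<lambda>z. \<Sum>i\<in>?I. c i * M i z)"
    unfolding mixed_moment_def kernel swap ..
  have "mixed_moment K p q = bihomogeneous_poly p q (\<lambda>\<alpha> \<beta>. c (\<alpha>, \<beta>))"
    unfolding eq by (rule ext) (simp add: bihomogeneous_poly_eq_sum M_def case_prod_beta')
  then show "\<exists>c. mixed_moment K p q = bihomogeneous_poly p q c" by blast
  have "laplacian (mixed_moment K p q) z = (\<Sum>i\<in>?I. c i * laplacian (M i) z)"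
    unfolding eq by (rule laplacian_linear_combination[OF M])
  also have "\<dots> = (\<integral>u. K u * (\<Sum>i\<in>?I. (a i * M (snd i, fst i) u) * laplacian (M i) z) \<partial>lborel)"
    by (rule swap[symmetric])
  also have "\<dots> = (\<integral>u. K u * laplacian (\<lambda>z. hprod u z ^ q * hprod z u ^ p) z \<partial>lborel)"
    unfolding kernel by (subst laplacian_linear_combination[OF M]) simp
  also have "\<dots> = (\<integral>u. (4 * of_nat p * of_nat q) * ((of_real ((norm u)\<^sup>2) * K u) * (hprod u z ^ (q - 1) * hprod z u ^ (p - 1))) \<partial>lborel)"
    unfolding laplacian_hprod_powers by (simp add: mult_ac)
  also have "\<dots> = 4 * of_nat p * of_nat q * mixed_moment (\<lambda>u. of_real ((norm u)\<^sup>2) * K u) (p - 1) (q - 1) z"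
    unfolding mixed_moment_def by (rule integral_mult_right_zero)
  finally show "laplacian (mixed_moment K p q) z =
      4 * of_nat p * of_nat q * mixed_moment (\<lambda>u. of_real ((norm u)\<^sup>2) * K u) (p - 1) (q - 1) z" .
qed

section \<open>Polar coordinates\<close>

abbreviation uniform_ball :: "'a::euclidean_space measure" where
  "uniform_ball \<equiv> uniform_measure lborel (ball 0 1)"

lemma nn_integral_lborel_affine:
  fixes g :: "'a::euclidean_space \<Rightarrow> ennreal"
  assumes [measurable]: "g \<in> borel_measurable borel" and c: "c \<noteq> 0"
  shows "integral\<^sup>N lborel g = ennreal (\<bar>c\<bar> ^ DIM('a)) * (\<integral>\<^sup>+x. g (t + c *\<^sub>R x) \<partial>lborel)"
  by (subst lborel_affine[OF c, of t])
     (simp add: nn_integral_density nn_integral_distr nn_integral_cmult)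

lemma nn_integral_inverse_power:
  assumes "a > 0" and n: "n > 0"
  shows "(\<integral>\<^sup>+s. indicator {a<..} s * ennreal (real n * (1 / s) ^ (n + 1)) \<partial>lborel) = ennreal ((1 / a) ^ n)"
proof -
  have "(\<integral>\<^sup>+s. indicator {a<..} s * ennreal (real n * (1 / s) ^ (n + 1)) \<partial>lborel) =
      (\<integral>\<^sup>+s. ennreal (real n * (1 / s) ^ (n + 1)) * indicator {a..} s \<partial>lborel)"
    using AE_lborel_singleton[of a]
    by (intro nn_integral_cong_AE) (auto elim!: eventually_mono simp: indicator_def)
  also have "\<dots> = ennreal (0 - (- ((1 / a) ^ n)))"
  proof (rule nn_integral_FTC_atLeast)
    fix x assume "a \<le> x"
    then have x: "x > 0" using assms by simp
    have "((\<lambda>x. - ((1 / x) ^ n)) has_real_derivative - (real n * (1 / x) ^ (n - 1) * (- 1 / x\<^sup>2))) (at x)"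
      using x by (auto intro!: derivative_eq_intros simp: power2_eq_square)
    then show "((\<lambda>x. - ((1 / x) ^ n)) has_real_derivative real n * (1 / x) ^ (n + 1)) (at x)"
      by (rule DERIV_cong) (use n x in \<open>auto simp: gr0_conv_Suc power2_eq_square power_one_over divide_simps\<close>)
  next
    have "((\<lambda>x::real. 1 / x) \<longlongrightarrow> 0) at_top"
      using tendsto_inverse_0_at_top[OF filterlim_ident] by (simp add: inverse_eq_divide)
    then have "((\<lambda>x::real. - ((1 / x) ^ n)) \<longlongrightarrow> - (0 ^ n)) at_top"
      by (intro tendsto_intros)
    moreover have "- (0 ^ n) = (0::real)" using n by simp
    ultimately show "((\<lambda>x::real. - ((1 / x) ^ n)) \<longlongrightarrow> 0) at_top" by (simp only:)
  qed (use assms in auto)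
  finally show ?thesis by simp
qed

text \<open>
  After Tonelli's theorem, the substitution \<open>r = \<bar>x\<bar> s\<close> in the radial variable removes the
  normalization of \<open>x\<close>, and \<open>y = s x\<close> in the ball then makes the integrand \<open>f y\<close> times an explicit
  function of \<open>\<bar>y\<bar>\<close> and \<open>s > \<bar>y\<bar>\<close>, whose integral over \<open>s\<close> is \<open>1\<close>.
\<close>
lemma nn_integral_polar:
  fixes f :: "'a::euclidean_space \<Rightarrow> ennreal"
  assumes [measurable]: "f \<in> borel_measurable borel"
  shows "(\<integral>\<^sup>+r. indicator {0<..} r * ennreal (real DIM('a) * r ^ (DIM('a) - 1)) *
      (\<integral>\<^sup>+x. indicator (ball 0 1) x * f ((r / norm x) *\<^sub>R x) \<partial>lborel) \<partial>lborel) = integral\<^sup>N lborel f"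
proof -
  let ?N = "DIM('a)"
  let ?B = "ball 0 1 :: 'a set"
  have N: "?N > 0" by simp
  have [measurable]: "?B \<in> sets borel" by simp
  have "(\<integral>\<^sup>+r. indicator {0<..} r * ennreal (real ?N * r ^ (?N - 1)) *
      (\<integral>\<^sup>+x. indicator ?B x * f ((r / norm x) *\<^sub>R x) \<partial>lborel) \<partial>lborel) =
    (\<integral>\<^sup>+r. (\<integral>\<^sup>+x. indicator {0<..} r * ennreal (real ?N * r ^ (?N - 1)) *
      (indicator ?B x * f ((r / norm x) *\<^sub>R x)) \<partial>lborel) \<partial>lborel)"
    by (intro nn_integral_cong nn_integral_cmult[symmetric]) simp
  also have "\<dots> = (\<integral>\<^sup>+x. (\<integral>\<^sup>+r. indicator {0<..} r * ennreal (real ?N * r ^ (?N - 1)) *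
      (indicator ?B x * f ((r / norm x) *\<^sub>R x)) \<partial>lborel) \<partial>lborel)"
    by (rule lborel_pair.Fubini') measurable
  also have "\<dots> = (\<integral>\<^sup>+x. (\<integral>\<^sup>+s. indicator {0<..} s * ennreal (real ?N * s ^ (?N - 1)) *
      (indicator ?B x * ennreal (norm x ^ ?N) * f (s *\<^sub>R x)) \<partial>lborel) \<partial>lborel)"
  proof (intro nn_integral_cong_AE, use AE_lborel_singleton[of 0] in eventually_elim)
    fix x :: 'a assume x: "x \<noteq> 0"
    let ?h = "\<lambda>r. indicator {0<..} r * ennreal (real ?N * r ^ (?N - 1)) * (indicator ?B x * f ((r / norm x) *\<^sub>R x))"
    have "(\<integral>\<^sup>+r. ?h r \<partial>lborel) = ennreal \<bar>norm x\<bar> * (\<integral>\<^sup>+s. ?h (0 + norm x * s) \<partial>lborel)"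
      using x by (intro nn_integral_real_affine) auto
    also have "\<dots> = (\<integral>\<^sup>+s. ennreal (norm x) * ?h (norm x * s) \<partial>lborel)"
      by (subst nn_integral_cmult) auto
    also have "\<dots> = (\<integral>\<^sup>+s. indicator {0<..} s * ennreal (real ?N * s ^ (?N - 1)) *
      (indicator ?B x * ennreal (norm x ^ ?N) * f (s *\<^sub>R x)) \<partial>lborel)"
    proof (intro nn_integral_cong)
      fix s :: real
      have "norm x * (real ?N * (norm x * s) ^ (?N - 1)) = (real ?N * s ^ (?N - 1)) * norm x ^ ?N"
        using N by (cases ?N) (auto simp: power_mult_distrib)
      then have *: "s > 0 \<Longrightarrow> ennreal (norm x) * ennreal (real ?N * (norm x * s) ^ (?N - 1)) =
          ennreal (real ?N * s ^ (?N - 1)) * ennreal (norm x ^ ?N)"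
        by (simp flip: ennreal_mult)
      have **: "(norm x * s / norm x) *\<^sub>R x = s *\<^sub>R x" using x by simp
      show "ennreal (norm x) * ?h (norm x * s) = indicator {0<..} s * ennreal (real ?N * s ^ (?N - 1)) *
          (indicator ?B x * ennreal (norm x ^ ?N) * f (s *\<^sub>R x))"
      proof (cases "s > 0")
        case True
        then have i: "indicator {0<..} (norm x * s) = (1::ennreal)" "indicator {0<..} s = (1::ennreal)"
          using x by auto
        have "ennreal (norm x) * ?h (norm x * s) =
            (ennreal (norm x) * ennreal (real ?N * (norm x * s) ^ (?N - 1))) * (indicator ?B x * f (s *\<^sub>R x))"
          unfolding i ** by (simp only: mult_ac mult_1)
        then show ?thesis unfolding *[OF True] i by (simp only: mult_ac mult_1)
      next
        case False
        then have "indicator {0<..} (norm x * s) = (0::ennreal)" "indicator {0<..} s = (0::ennreal)"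
          using x by (auto simp: indicator_def zero_less_mult_iff)
        then show ?thesis by simp
      qed
    qed
    finally show "(\<integral>\<^sup>+r. ?h r \<partial>lborel) = (\<integral>\<^sup>+s. indicator {0<..} s * ennreal (real ?N * s ^ (?N - 1)) *
      (indicator ?B x * ennreal (norm x ^ ?N) * f (s *\<^sub>R x)) \<partial>lborel)" .
  qed
  also have "\<dots> = (\<integral>\<^sup>+s. (\<integral>\<^sup>+x. indicator {0<..} s * ennreal (real ?N * s ^ (?N - 1)) *
      (indicator ?B x * ennreal (norm x ^ ?N) * f (s *\<^sub>R x)) \<partial>lborel) \<partial>lborel)"
    by (rule lborel_pair.Fubini') measurable
  also have "\<dots> = (\<integral>\<^sup>+s. (\<integral>\<^sup>+y. indicator {norm y<..} s * ennreal (real ?N * (1 / s) ^ (?N + 1)) *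
      (ennreal (norm y ^ ?N) * f y) \<partial>lborel) \<partial>lborel)"
  proof (rule nn_integral_cong)
    fix s :: real
    let ?h = "\<lambda>x. indicator {0<..} s * ennreal (real ?N * s ^ (?N - 1)) *
      (indicator ?B x * ennreal (norm x ^ ?N) * f (s *\<^sub>R x))"
    show "(\<integral>\<^sup>+x. ?h x \<partial>lborel) = (\<integral>\<^sup>+y. indicator {norm y<..} s * ennreal (real ?N * (1 / s) ^ (?N + 1)) *
      (ennreal (norm y ^ ?N) * f y) \<partial>lborel)"
    proof (cases "s > 0")
      case True
      have "(\<integral>\<^sup>+x. ?h x \<partial>lborel) = ennreal (\<bar>1 / s\<bar> ^ ?N) * (\<integral>\<^sup>+y. ?h (0 + (1 / s) *\<^sub>R y) \<partial>lborel)"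
        using True by (intro nn_integral_lborel_affine) auto
      also have "\<dots> = (\<integral>\<^sup>+y. ennreal ((1 / s) ^ ?N) * ?h ((1 / s) *\<^sub>R y) \<partial>lborel)"
        using True by (subst nn_integral_cmult) auto
      also have "\<dots> = (\<integral>\<^sup>+y. indicator {norm y<..} s * ennreal (real ?N * (1 / s) ^ (?N + 1)) *
          (ennreal (norm y ^ ?N) * f y) \<partial>lborel)"
      proof (intro nn_integral_cong)
        fix y :: 'a
        have "(1 / s) ^ ?N * (real ?N * s ^ (?N - 1)) * norm ((1 / s) *\<^sub>R y) ^ ?N =
            real ?N * (1 / s) ^ (?N + 1) * norm y ^ ?N"
          using True N by (cases ?N) (auto simp: power_mult_distrib power_divide field_simps)
        then have *: "ennreal ((1 / s) ^ ?N) * ennreal (real ?N * s ^ (?N - 1)) * ennreal (norm ((1 / s) *\<^sub>R y) ^ ?N) =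
            ennreal (real ?N * (1 / s) ^ (?N + 1)) * ennreal (norm y ^ ?N)"
          using True by (simp only: ennreal_mult[symmetric] zero_le_power zero_le_mult_iff
              norm_ge_zero of_nat_0_le_iff less_imp_le zero_le_divide_1_iff simp_thms)
        have i: "indicator ?B ((1 / s) *\<^sub>R y) = (indicator {norm y<..} s :: ennreal)" "indicator {0<..} s = (1 :: ennreal)"
          using True by (auto simp: indicator_def field_simps)
        have ss: "s *\<^sub>R (1 / s) *\<^sub>R y = y" using True by simp
        have "ennreal ((1 / s) ^ ?N) * ?h ((1 / s) *\<^sub>R y) = indicator {norm y<..} s *
            (ennreal ((1 / s) ^ ?N) * ennreal (real ?N * s ^ (?N - 1)) * ennreal (norm ((1 / s) *\<^sub>R y) ^ ?N)) * f y"
          unfolding i ss by (simp only: mult_ac mult_1)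
        then show "ennreal ((1 / s) ^ ?N) * ?h ((1 / s) *\<^sub>R y) = indicator {norm y<..} s * ennreal (real ?N * (1 / s) ^ (?N + 1)) *
          (ennreal (norm y ^ ?N) * f y)"
          unfolding * by (simp only: mult_ac)
      qed
      finally show ?thesis .
    next
      case False
      then have "indicator {norm y<..} s = (0::ennreal)" for y :: 'a
        using norm_ge_zero[of y] by (auto simp: indicator_def simp del: norm_ge_zero)
      with False show ?thesis by simp
    qed
  qed
  also have "\<dots> = (\<integral>\<^sup>+y. (\<integral>\<^sup>+s. indicator {norm y<..} s * ennreal (real ?N * (1 / s) ^ (?N + 1)) *
      (ennreal (norm y ^ ?N) * f y) \<partial>lborel) \<partial>lborel)"
    unfolding greaterThan_iff indicator_def
    by (rule lborel_pair.Fubini') measurable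
  also have "\<dots> = (\<integral>\<^sup>+y. f y \<partial>lborel)"
  proof (intro nn_integral_cong_AE, use AE_lborel_singleton[of 0] in eventually_elim)
    fix y :: 'a assume y: "y \<noteq> 0"
    have "(\<integral>\<^sup>+s. indicator {norm y<..} s * ennreal (real ?N * (1 / s) ^ (?N + 1)) * (ennreal (norm y ^ ?N) * f y) \<partial>lborel) =
        (\<integral>\<^sup>+s. indicator {norm y<..} s * ennreal (real ?N * (1 / s) ^ (?N + 1)) \<partial>lborel) * (ennreal (norm y ^ ?N) * f y)"
      by (rule nn_integral_multc) measurable
    also have "\<dots> = ennreal ((1 / norm y) ^ ?N) * ennreal (norm y ^ ?N) * f y"
      using y by (subst nn_integral_inverse_power) (auto simp: mult.assoc)
    also have "ennreal ((1 / norm y) ^ ?N) * ennreal (norm y ^ ?N) = 1"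
      using y by (simp flip: ennreal_mult power_mult_distrib)
    finally show "(\<integral>\<^sup>+s. indicator {norm y<..} s * ennreal (real ?N * (1 / s) ^ (?N + 1)) * (ennreal (norm y ^ ?N) * f y) \<partial>lborel) = f y"
      by simp
  qed
  finally show ?thesis .
qed

lemma measure_unit_ball_pos: "measure lborel (ball 0 1 :: 'a::euclidean_space set) > 0"
  and emeasure_unit_ball: "emeasure lborel (ball 0 1 :: 'a set) = ennreal (measure lborel (ball 0 1 :: 'a set))"
proof -
  have fin: "emeasure lborel (ball 0 1 :: 'a set) \<noteq> \<infinity>"
    using emeasure_lborel_ball_finite[of "0::'a" 1] by simp
  then show "emeasure lborel (ball 0 1 :: 'a set) = ennreal (measure lborel (ball 0 1 :: 'a set))"
    by (intro emeasure_eq_ennreal_measure) auto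
  have "emeasure lborel (ball 0 1 :: 'a set) \<noteq> 0"
    using open_not_negligible[of "ball 0 1 :: 'a set"] by (auto simp: negligible_iff_emeasure0)
  with fin show "measure lborel (ball 0 1 :: 'a::euclidean_space set) > 0"
    by (simp add: measure_def enn2real_positive_iff less_top zero_less_iff_neq_zero)
qed

text \<open>
  The volume of the unit ball appears in the density because \<open>uniform_ball\<close> is normalized. The
  argument of type \<open>itself\<close> carries the dimension.
\<close>
definition radial_measure :: "'a::euclidean_space itself \<Rightarrow> real measure" where
  "radial_measure _ = density lborel (\<lambda>r. ennreal (indicator {0<..} r *
     (measure lborel (ball 0 1 :: 'a set) * (real DIM('a) * r ^ (DIM('a) - 1)))))"

lemma sets_radial_measure [measurable_cong]: "sets (radial_measure a) = sets borel"
  by (simp add: radial_measure_def)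

lemma pair_sigma_finite_polar:
  "pair_sigma_finite (radial_measure TYPE('a::euclidean_space)) (uniform_ball :: 'a measure)"
proof (intro pair_sigma_finite.intro)
  show "sigma_finite_measure (radial_measure TYPE('a))"
    unfolding radial_measure_def
    by (subst sigma_finite_measure.sigma_finite_iff_density_finite[OF sigma_finite_lborel]) auto
  have "prob_space (uniform_ball :: 'a measure)"
    by (rule prob_space_uniform_measure) (use measure_unit_ball_pos[where 'a = 'a] emeasure_unit_ball[where 'a = 'a] in auto)
  then show "sigma_finite_measure (uniform_ball :: 'a measure)"
    by (simp add: prob_space.finite_measure finite_measure.sigma_finite_measure prob_space_imp_sigma_finite)
qed

lemma lborel_polar:
  "(lborel :: 'a::euclidean_space measure) =
    distr (radial_measure TYPE('a) \<Otimes>\<^sub>M uniform_ball) borel (\<lambda>(r, x). (r / norm x) *\<^sub>R x)"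
proof (rule measure_eqI)
  let ?R = "radial_measure TYPE('a)" and ?U = "uniform_ball :: 'a measure"
  let ?N = "DIM('a)" and ?V = "measure lborel (ball 0 1 :: 'a set)"
  interpret pair_sigma_finite ?R ?U by (rule pair_sigma_finite_polar)
  let ?pol = "\<lambda>(r, x). (r / norm x) *\<^sub>R x :: 'a"
  fix A :: "'a set" assume "A \<in> sets lborel"
  then have [measurable]: "A \<in> sets borel" by simp
  have "emeasure (distr (?R \<Otimes>\<^sub>M ?U) borel ?pol) A = (\<integral>\<^sup>+y. indicator A y \<partial>distr (?R \<Otimes>\<^sub>M ?U) borel ?pol)"
    by simp
  also have "\<dots> = (\<integral>\<^sup>+p. indicator A (?pol p) \<partial>(?R \<Otimes>\<^sub>M ?U))"
    by (rule nn_integral_distr) measurable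
  also have "\<dots> = (\<integral>\<^sup>+r. (\<integral>\<^sup>+x. indicator A ((r / norm x) *\<^sub>R x) \<partial>?U) \<partial>?R)"
    by (subst M2.nn_integral_fst[symmetric]) auto
  also have "\<dots> = (\<integral>\<^sup>+r. indicator {0<..} r * ennreal (real ?N * r ^ (?N - 1)) *
      (\<integral>\<^sup>+x. indicator (ball 0 1) x * indicator A ((r / norm x) *\<^sub>R x) \<partial>lborel) \<partial>lborel)"
    unfolding radial_measure_def
  proof (subst nn_integral_density)
    show "(\<integral>\<^sup>+r. ennreal (indicator {0<..} r * (?V * (real ?N * r ^ (?N - 1)))) *
        (\<integral>\<^sup>+x. indicator A ((r / norm x) *\<^sub>R x) \<partial>?U) \<partial>lborel) =
      (\<integral>\<^sup>+r. indicator {0<..} r * ennreal (real ?N * r ^ (?N - 1)) *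
      (\<integral>\<^sup>+x. indicator (ball 0 1) x * indicator A ((r / norm x) *\<^sub>R x) \<partial>lborel) \<partial>lborel)"
    proof (rule nn_integral_cong)
      fix r :: real
      let ?I = "\<integral>\<^sup>+x. indicator (ball 0 1) x * indicator A ((r / norm x) *\<^sub>R (x::'a)) \<partial>lborel"
      have U: "(\<integral>\<^sup>+x. indicator A ((r / norm x) *\<^sub>R x) \<partial>?U) = ?I / ennreal ?V"
        by (subst nn_integral_uniform_measure) (auto simp: emeasure_unit_ball mult.commute)
      show "ennreal (indicator {0<..} r * (?V * (real ?N * r ^ (?N - 1)))) *
        (\<integral>\<^sup>+x. indicator A ((r / norm x) *\<^sub>R x) \<partial>?U) =
          indicator {0<..} r * ennreal (real ?N * r ^ (?N - 1)) * ?I"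
      proof (cases "r > 0")
        case True
        have "ennreal (?V * (real ?N * r ^ (?N - 1))) = ennreal ?V * ennreal (real ?N * r ^ (?N - 1))"
          using True by (intro ennreal_mult) auto
        moreover have "ennreal ?V * (?I / ennreal ?V) = ?I"
          using measure_unit_ball_pos[where 'a = 'a]
          by (simp only: ennreal_times_divide mult.commute[of "ennreal ?V"]) (rule mult_divide_eq_ennreal; simp)
        moreover have ac_eq: "V * M * (I / V) = M * (V * (I / V))" for V M I :: ennreal
          by (simp only: mult_ac)
        moreover have "indicator {0<..} r = (1::real)" "indicator {0<..} r = (1::ennreal)"
          using True by auto
        ultimately show ?thesis unfolding U
          by (simp only: mult_1 mult_1_left ac_eq)
      qed simp
    qed
  qed measurable
  also have "\<dots> = emeasure lborel A"
    by (subst nn_integral_polar) auto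
  finally show "emeasure lborel A = emeasure (distr (?R \<Otimes>\<^sub>M ?U) borel ?pol) A" ..
qed simp

section \<open>Integrals over spheres\<close>

lemma integral_sphere_measure:
  fixes k :: "'a::euclidean_space \<Rightarrow> 'b::{banach, second_countable_topology}"
  assumes [measurable]: "k \<in> borel_measurable borel"
  shows "integral\<^sup>L (sphere_measure r) k = (\<integral>x. k ((r / norm x) *\<^sub>R x) \<partial>uniform_ball)"
  unfolding sphere_measure_def by (subst integral_completion) (auto simp: integral_distr)

lemma integral_polar:
  fixes k :: "'a::euclidean_space \<Rightarrow> complex"
  assumes k: "integrable lborel k"
  shows "integral\<^sup>L lborel k =
    (\<integral>r. (indicator {0<..} r * (measure lborel (ball 0 1 :: 'a set) * (real DIM('a) * r ^ (DIM('a) - 1)))) *\<^sub>R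
      integral\<^sup>L (sphere_measure r) k \<partial>lborel)"
proof -
  let ?R = "radial_measure TYPE('a)" and ?U = "uniform_ball :: 'a measure"
  let ?pol = "\<lambda>(r, x). (r / norm x) *\<^sub>R x :: 'a"
  interpret pair_sigma_finite ?R ?U by (rule pair_sigma_finite_polar)
  have [measurable]: "k \<in> borel_measurable borel" using k by auto
  have "integrable (distr (?R \<Otimes>\<^sub>M ?U) borel ?pol) k"
    using k lborel_polar[where 'a = 'a] by simp
  then have int: "integrable (?R \<Otimes>\<^sub>M ?U) (\<lambda>p. k (?pol p))"
    by (subst (asm) integrable_distr_eq) auto
  have "integral\<^sup>L lborel k = integral\<^sup>L (distr (?R \<Otimes>\<^sub>M ?U) borel ?pol) k"
    using lborel_polar[where 'a = 'a] by simp
  also have "\<dots> = (\<integral>p. k (?pol p) \<partial>(?R \<Otimes>\<^sub>M ?U))"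
    by (rule integral_distr) measurable
  also have "\<dots> = (\<integral>r. (\<integral>x. k (?pol (r, x)) \<partial>?U) \<partial>?R)"
    by (rule integral_fst'[OF int, symmetric])
  also have "\<dots> = (\<integral>r. integral\<^sup>L (sphere_measure r) k \<partial>?R)"
    by (simp add: integral_sphere_measure)
  also have "\<dots> = (\<integral>r. (indicator {0<..} r * (measure lborel (ball 0 1 :: 'a set) * (real DIM('a) * r ^ (DIM('a) - 1)))) *\<^sub>R
      integral\<^sup>L (sphere_measure r) k \<partial>lborel)"
    unfolding radial_measure_def
    by (subst integral_density) (auto simp: integral_sphere_measure indicator_def)
  finally show ?thesis .
qed

text \<open>
  A null set of the space pulls back to a null set of the product in \<open>lborel_polar\<close>, almost all of whose
  sections are null.
\<close>
lemma AE_sphere_measure: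
  fixes Q :: "'a::euclidean_space \<Rightarrow> bool"
  assumes "AE w in lborel. Q w"
  shows "AE r in lborel. r > 0 \<longrightarrow> (AE w in sphere_measure r. Q w)"
proof -
  let ?R = "radial_measure TYPE('a)" and ?U = "uniform_ball :: 'a measure"
  let ?pol = "\<lambda>(r, x). (r / norm x) *\<^sub>R x :: 'a"
  interpret pair_sigma_finite ?R ?U by (rule pair_sigma_finite_polar)
  obtain N where N: "{w. \<not> Q w} \<subseteq> N" "N \<in> sets lborel" "emeasure lborel N = 0"
    using assms by (auto elim!: AE_E)
  have [measurable]: "N \<in> sets borel" using N by simp
  have "AE w in lborel. w \<notin> N" using N(2,3) by (intro AE_not_in) (auto simp: null_sets_def)
  then have "AE w in distr (?R \<Otimes>\<^sub>M ?U) borel ?pol. w \<notin> N"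
    unfolding lborel_polar[symmetric] .
  then have "AE p in ?R \<Otimes>\<^sub>M ?U. ?pol p \<notin> N"
    by (subst (asm) AE_distr_iff) auto
  then have "AE r in ?R. AE x in ?U. ?pol (r, x) \<notin> N" by (rule AE_pair)
  then have "AE r in lborel. 0 < ennreal (indicator {0<..} r * (measure lborel (ball 0 1 :: 'a set) * (real DIM('a) * r ^ (DIM('a) - 1)))) \<longrightarrow>
      (AE x in ?U. ?pol (r, x) \<notin> N)"
    unfolding radial_measure_def by (subst (asm) AE_density) auto
  then show ?thesis
  proof eventually_elim
    case (elim r)
    show ?case
    proof
      assume r: "r > 0"
      then have "AE x in ?U. ?pol (r, x) \<notin> N"
        using elim measure_unit_ball_pos[where 'a = 'a] by simp
      then have "AE w in distr ?U borel (\<lambda>x. (r / norm x) *\<^sub>R x). w \<notin> N"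
        by (subst AE_distr_iff) auto
      then have "AE w in sphere_measure r. w \<notin> N"
        unfolding sphere_measure_def by (simp add: AE_completion_iff)
      then show "AE w in sphere_measure r. Q w"
        by eventually_elim (use N(1) in auto)
    qed
  qed
qed

lemma borel_measurable_completion_AE_cong:
  assumes g: "g \<in> borel_measurable (completion M)" and ae: "AE x in completion M. f x = g x"
  shows "f \<in> borel_measurable (completion M)"
proof (rule measurableI)
  fix A :: "'b set" assume A: "A \<in> sets borel"
  show "f -` A \<inter> space (completion M) \<in> sets (completion M)"
  proof (rule completion.in_sets_AE)
    show "AE x in completion M. x \<in> g -` A \<inter> space (completion M) \<longleftrightarrow> x \<in> f -` A \<inter> space (completion M)"
      using ae by eventually_elim auto
    show "g -` A \<inter> space (completion M) \<in> sets (completion M)"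
      using g A by (rule measurable_sets)
  qed auto
qed simp

text \<open>
  As \<open>k\<close> is only known to agree almost everywhere with a Borel function, its measurability on almost
  every sphere comes from the completeness of \<open>sphere_measure\<close>.
\<close>
lemma sphere_integral_AE_cong:
  fixes k k' :: "'a::euclidean_space \<Rightarrow> complex"
  assumes ae: "AE w in lborel. k w = k' w" and k': "k' \<in> borel_measurable borel"
  shows "AE r in lborel. r > 0 \<longrightarrow> integral\<^sup>L (sphere_measure r) k = integral\<^sup>L (sphere_measure r) k'"
  using AE_sphere_measure[OF ae]
proof eventually_elim
  case (elim r)
  show ?case
  proof
    assume "r > 0"
    then have eq: "AE w in sphere_measure r. k w = k' w" using elim by simp
    have meas: "k' \<in> borel_measurable (sphere_measure r)"
      unfolding sphere_measure_def by (rule measurable_completion) (simp add: k')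
    then have "k \<in> borel_measurable (sphere_measure r)"
      using eq unfolding sphere_measure_def by (rule borel_measurable_completion_AE_cong)
    then show "integral\<^sup>L (sphere_measure r) k = integral\<^sup>L (sphere_measure r) k'"
      using meas eq by (rule integral_cong_AE)
  qed
qed

lemma sphere_integral_mult_radial:
  fixes k :: "'a::euclidean_space \<Rightarrow> complex"
  assumes [measurable]: "k \<in> borel_measurable borel" "\<rho> \<in> borel_measurable borel" and r: "r > 0"
  shows "(\<integral>w. k w * \<rho> (norm w) \<partial>sphere_measure r) = integral\<^sup>L (sphere_measure r) k * \<rho> r"
proof -
  have [measurable]: "ball 0 1 \<in> sets (borel :: 'a measure)" by simp
  have "AE x in uniform_ball. x \<noteq> (0::'a)"
    unfolding uniform_measure_def using AE_lborel_singleton[of "0::'a"]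
    by (subst AE_density) (auto elim!: eventually_mono)
  then have ae: "AE x in uniform_ball. k ((r / norm x) *\<^sub>R x) * \<rho> (norm ((r / norm x) *\<^sub>R x)) =
      k ((r / norm x) *\<^sub>R x) * \<rho> r"
    by eventually_elim (use r in simp)
  have "(\<integral>x. k ((r / norm x) *\<^sub>R x) * \<rho> (norm ((r / norm x) *\<^sub>R x)) \<partial>uniform_ball) =
      (\<integral>x. k ((r / norm x) *\<^sub>R x) * \<rho> r \<partial>uniform_ball)"
    by (rule integral_cong_AE[OF _ _ ae]) measurable
  then show ?thesis by (simp add: integral_sphere_measure)
qed

lemma radial_integral_eq_0_if_sphere_integrals_eq_0:
  fixes k k' :: "'a::euclidean_space \<Rightarrow> complex"
  assumes ae: "AE w in lborel. k w = k' w" and k': "k' \<in> borel_measurable borel"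
    and \<rho>: "\<rho> \<in> borel_measurable borel" and int: "integrable lborel (\<lambda>w. k' w * \<rho> (norm w))"
    and zero: "\<And>r. r > 0 \<Longrightarrow> integral\<^sup>L (sphere_measure r) k = 0"
  shows "(\<integral>w. k' w * \<rho> (norm w) \<partial>lborel) = 0"
  unfolding integral_polar[OF int]
proof (rule integral_eq_zero_AE)
  show "AE r in lborel. (indicator {0<..} r * (measure lborel (ball 0 1 :: 'a set) * (real DIM('a) * r ^ (DIM('a) - 1)))) *\<^sub>R
      (\<integral>w. k' w * \<rho> (norm w) \<partial>sphere_measure r) = 0"
    using sphere_integral_AE_cong[OF ae k']
  proof eventually_elim
    case (elim r)
    then show ?case
      using zero[of r] sphere_integral_mult_radial[OF k' \<rho>, of r] by (cases "r > 0") auto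
  qed
qed

lemma continuous_on_sphere_integral:
  fixes k :: "'a::euclidean_space \<Rightarrow> complex"
  assumes cont: "continuous_on UNIV k" and bnd: "\<And>w. norm (k w) \<le> B"
  shows "continuous_on UNIV (\<lambda>r. integral\<^sup>L (sphere_measure r) k)"
    and "norm (integral\<^sup>L (sphere_measure r) k) \<le> B"
proof -
  have [measurable]: "k \<in> borel_measurable borel" using cont by (rule borel_measurable_continuous_onI)
  interpret prob_space "uniform_ball :: 'a measure"
    by (rule prob_space_uniform_measure)
       (use measure_unit_ball_pos[where 'a = 'a] emeasure_unit_ball[where 'a = 'a] in auto)
  have "integrable uniform_ball (\<lambda>x. k ((r / norm x) *\<^sub>R x))" for r
    by (rule integrable_const_bound[where B = B]) (auto simp: bnd)
  then have "norm (\<integral>x. k ((r / norm x) *\<^sub>R x) \<partial>uniform_ball) \<le> (\<integral>x. B \<partial>(uniform_ball :: 'a measure))"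
    by (intro Bochner_Integration.integral_norm_bound_integral) (auto simp: bnd)
  then show "norm (integral\<^sup>L (sphere_measure r) k) \<le> B"
    using prob_space by (simp add: integral_sphere_measure)
  show "continuous_on UNIV (\<lambda>r. integral\<^sup>L (sphere_measure r) k)"
    unfolding continuous_on_sequentially
  proof (intro allI impI ballI)
    fix x :: "nat \<Rightarrow> real" and a assume "(\<forall>n. x n \<in> UNIV) \<and> x \<longlonglongrightarrow> a"
    then have x: "x \<longlonglongrightarrow> a" by simp
    have "(\<lambda>n. \<integral>y. k ((x n / norm y) *\<^sub>R y) \<partial>uniform_ball) \<longlonglongrightarrow> (\<integral>y. k ((a / norm y) *\<^sub>R y) \<partial>uniform_ball)"
    proof (rule integral_dominated_convergence[where w = "\<lambda>_. B"])
      show "AE y in uniform_ball. (\<lambda>n. k ((x n / norm y) *\<^sub>R y)) \<longlonglongrightarrow> k ((a / norm y) *\<^sub>R y)"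
      proof (rule AE_I2)
        fix y :: 'a
        have "isCont k ((a / norm y) *\<^sub>R y)" using cont by (simp add: continuous_on_eq_continuous_at)
        moreover have "(\<lambda>n. (x n / norm y) *\<^sub>R y) \<longlonglongrightarrow> (a / norm y) *\<^sub>R y"
          unfolding divide_inverse by (intro tendsto_intros x)
        ultimately show "(\<lambda>n. k ((x n / norm y) *\<^sub>R y)) \<longlonglongrightarrow> k ((a / norm y) *\<^sub>R y)"
          by (rule isCont_tendsto_compose)
      qed
    qed (auto simp: bnd)
    then show "((\<lambda>r. integral\<^sup>L (sphere_measure r) k) \<circ> x) \<longlonglongrightarrow> integral\<^sup>L (sphere_measure a) k"
      by (simp add: integral_sphere_measure o_def)
  qed
qed

text \<open>
  Extend \<open>h\<close> to an even function on the line. Its odd moments against a Gaussian vanish by symmetry,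
  and its even moments by expanding the hypothesis in the parameter \<open>a\<close>. Hence its integrals
  against shifted Gaussians vanish, and these determine it.
\<close>
lemma half_line_gaussian_uniqueness:
  fixes h :: "real \<Rightarrow> complex"
  assumes meas [measurable]: "h \<in> borel_measurable borel"
    and bnd: "\<And>r. norm (h r) \<le> C * exp (R * \<bar>r\<bar>)"
    and zero: "\<And>a. a > 0 \<Longrightarrow> (\<integral>r. indicator {0<..} r *\<^sub>R (h r * gaussian a r) \<partial>lborel) = 0"
  shows "AE r in lborel. r > 0 \<longrightarrow> h r = 0"
proof -
  define E where "E r = h \<bar>r\<bar>" for r
  have E_meas [measurable]: "E \<in> borel_measurable borel" unfolding E_def by measurable
  have E: "exp_growth E"
    by (rule exp_growthI[OF E_meas, of C R]) (use bnd[of "\<bar>r\<bar>" for r] in \<open>simp add: E_def\<close>)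
  have id: "exp_growth (\<lambda>r::real. of_real r :: complex)"
    by (rule exp_growth_linear[OF bounded_linear_of_real])
  have int: "integrable lborel (\<lambda>r. p r * gaussian a r)" if "exp_growth p" "a > 0" for p and a :: real
    using that by (intro exp_integrable_integrable exp_integrable_mult exp_integrable_gaussian)
  have E0: "(\<integral>r. E r * gaussian a r \<partial>lborel) = 0" if a: "a > 0" for a
  proof -
    let ?g = "\<lambda>r. indicator {0<..} r *\<^sub>R (h r * gaussian a r)"
    have refl: "integral\<^sup>L lborel ?g = (\<integral>r. ?g (0 + -1 * r) \<partial>lborel)"
      using lborel_integral_real_affine[of "-1" ?g 0] by simp
    have intg: "integrable lborel ?g"
    proof (rule Bochner_Integration.integrable_bound[OF int[OF E a]])
      show "AE r in lborel. norm (?g r) \<le> norm (E r * gaussian a r)"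
        by (auto simp: E_def indicator_def)
    qed measurable
    have intg': "integrable lborel (\<lambda>r. ?g (0 + -1 * r))"
      by (rule lborel_integrable_real_affine[OF intg]) simp
    have "(\<integral>r. E r * gaussian a r \<partial>lborel) = (\<integral>r. ?g r + ?g (0 + -1 * r) \<partial>lborel)"
      using AE_lborel_singleton[of "0::real"]
      by (intro integral_cong_AE) (auto elim!: eventually_mono simp: E_def indicator_def)
    also have "\<dots> = integral\<^sup>L lborel ?g + (\<integral>r. ?g (0 + -1 * r) \<partial>lborel)"
      by (rule Bochner_Integration.integral_add[OF intg intg'])
    also have "\<dots> = 0" using refl zero[OF a] by simp
    finally show ?thesis .
  qed
  have moments: "(\<integral>r. (E r * gaussian a r) * of_real r ^ d \<partial>lborel) = 0" if a: "a > 0" for a d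
  proof (cases "even d")
    case True
    then obtain m where m: "d = 2 * m" by blast
    have "(\<integral>r. (E r * gaussian a r) * (of_real (r\<^sup>2)) ^ m \<partial>lborel) = 0"
    proof (rule moments_eq_0_if_exp_integral_eq_0[where \<epsilon> = "a / 2"])
      show "integrable lborel (\<lambda>r. exp (a / 2 * norm (of_real (r\<^sup>2) :: complex)) *\<^sub>R (E r * gaussian a r))"
      proof -
        have "exp (a / 2 * r\<^sup>2) * exp (- a * r\<^sup>2) = exp (- (a / 2) * r\<^sup>2)" for r
          by (simp flip: exp_add)
        then have "exp (a / 2 * norm (of_real (r\<^sup>2) :: complex)) *\<^sub>R (E r * gaussian a r) = E r * gaussian (a / 2) r" for r
          by (simp add: scaleR_conv_of_real mult_ac norm_power flip: of_real_mult)
        then show ?thesis using int[OF E, of "a / 2"] a by simp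
      qed
      fix t :: real assume t: "\<bar>t\<bar> < a / 2"
      have "exp (- a * r\<^sup>2) * exp (t * r\<^sup>2) = exp (- (a - t) * r\<^sup>2)" for r
        by (simp add: algebra_simps flip: exp_add)
      moreover have "exp (of_real t * of_real (r\<^sup>2)) = (of_real (exp (t * r\<^sup>2)) :: complex)" for r
        by (simp only: exp_of_real flip: of_real_mult)
      ultimately have eq: "(E r * gaussian a r) * exp (of_real t * of_real (r\<^sup>2)) = E r * gaussian (a - t) r" for r
        by (simp only: mult.assoc real_norm_def power2_abs flip: of_real_mult)
      show "(\<integral>r. (E r * gaussian a r) * exp (of_real t * of_real (r\<^sup>2)) \<partial>lborel) = 0"
        unfolding eq by (rule E0) (use t in linarith)
    qed (use a in auto)
    then show ?thesis by (simp add: m power_mult)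
  next
    case False
    let ?g = "\<lambda>r. (E r * gaussian a r) * of_real r ^ d"
    have odd: "?g (0 + -1 * r) = - ?g r" for r
      using False by (simp add: E_def)
    have "integral\<^sup>L lborel ?g = \<bar>-1\<bar> *\<^sub>R (\<integral>r. ?g (0 + -1 * r) \<partial>lborel)"
      by (rule lborel_integral_real_affine) simp
    also have "\<dots> = - integral\<^sup>L lborel ?g" by (simp only: odd) simp
    finally show ?thesis by simp
  qed
  define H where "H r = E r * gaussian 1 r" for r
  have "AE r in lborel. H r = 0"
  proof (rule AE_eq_0_if_gaussian_exp_integrals_eq_0)
    show "integrable lborel H" unfolding H_def[abs_def] by (rule int[OF E]) simp
    fix a y :: real assume a: "a > 0"
    have Hg: "H r * gaussian a r = E r * gaussian (1 + a) r" for r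
      by (simp add: H_def mult.assoc algebra_simps flip: of_real_mult exp_add)
    show "(\<integral>r. H r * gaussian a r * exp (of_real (r \<bullet> y)) \<partial>lborel) = 0"
      unfolding Hg
    proof (rule exp_integral_eq_0_if_moments_eq_0)
      have "exp_integrable (\<lambda>r. E r * gaussian (1 + a) r)"
        using a by (intro exp_integrable_mult E exp_integrable_gaussian) simp
      then show "integrable lborel (\<lambda>r. exp (norm (of_real (r \<bullet> y) :: complex)) *\<^sub>R (E r * gaussian (1 + a) r))"
        by (rule exp_integrable_exp_norm_linear)
           (intro bounded_linear_compose[OF bounded_linear_of_real] bounded_linear_inner_left)
      fix d
      have "(\<integral>r. (E r * gaussian (1 + a) r) * of_real (r \<bullet> y) ^ d \<partial>lborel) =
          (\<integral>r. ((E r * gaussian (1 + a) r) * of_real r ^ d) * of_real y ^ d \<partial>lborel)"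
        by (simp add: power_mult_distrib mult.assoc)
      also have "\<dots> = 0" using moments[of "1 + a" d] a by (simp del: of_real_power)
      finally show "(\<integral>r. (E r * gaussian (1 + a) r) * of_real (r \<bullet> y) ^ d \<partial>lborel) = 0" .
    qed measurable
  qed
  then show ?thesis by eventually_elim (auto simp: H_def E_def)
qed

section \<open>Twisted spherical means and mixed moments\<close>

text \<open>
  The integrand of the twisted spherical mean, so that the means at \<open>z\<close> are the integrals of one
  function over the spheres about the origin.
\<close>
definition twisted_translate :: "(complex ^ 'n \<Rightarrow> complex) \<Rightarrow> complex ^ 'n \<Rightarrow> complex ^ 'n \<Rightarrow> complex" where
  "twisted_translate f z w = f (z - w) * exp (\<i> / 2 * of_real (Im (hprod z w)))"

lemma twisted_spherical_mean_eq:
  "twisted_spherical_mean f r z = integral\<^sup>L (sphere_measure r) (twisted_translate f z)"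
  unfolding twisted_spherical_mean_def twisted_translate_def[abs_def] hprod_def ..

lemma continuous_on_hprod_right: "continuous_on S (\<lambda>w. hprod z w)"
  by (intro linear_continuous_on bounded_linear_hprod_right)

lemma twisted_translate_measurable [measurable]:
  assumes "f \<in> borel_measurable borel"
  shows "twisted_translate f z \<in> borel_measurable borel"
proof -
  have "(\<lambda>w. f (z - w)) \<in> borel_measurable borel"
    by (rule measurable_compose[OF _ assms]) simp
  moreover have "(\<lambda>w. exp (\<i> / 2 * of_real (Im (hprod z w)))) \<in> borel_measurable borel"
    by (intro borel_measurable_continuous_onI continuous_intros continuous_on_hprod_right)
  ultimately show ?thesis unfolding twisted_translate_def[abs_def] by (rule borel_measurable_times)
qed

lemma norm_twisted_translate: "norm (twisted_translate f z w) = norm (f (z - w))"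
  by (simp add: twisted_translate_def norm_mult)

text \<open>
  Since \<open>\<bar>z - u\<bar>\<^sup>2 = \<bar>z\<bar>\<^sup>2 + \<bar>u\<bar>\<^sup>2 - 2 Re (hprod z u)\<close>, and the twist contributes a multiple of \<open>Im (hprod z u)\<close>, the exponent is
  Gaussian in \<open>z\<close> and in \<open>u\<close> up to a form that is linear in \<open>hprod z u\<close> and its conjugate \<open>hprod u z\<close>.
\<close>
lemma twisted_gaussian_kernel:
  "exp (\<i> / 2 * of_real (Im (hprod z (z - u)))) * gaussian (a / 4) (z - u) =
   gaussian (a / 4) z * (gaussian (a / 4) u *
     exp (of_real ((a + 1) / 4) * hprod u z + of_real ((a - 1) / 4) * hprod z u))"
proof -
  define s where "s = hprod z u"
  have s': "hprod u z = cnj s" by (simp add: s_def cnj_hprod)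
  have "hprod z (z - u) = hprod z z - hprod z u"
    using hprod_add_right[of z "z - u" u] by (simp add: algebra_simps)
  then have im: "Im (hprod z (z - u)) = - Im s" by (simp add: hprod_self s_def)
  have "(norm (z - u))\<^sup>2 = (norm z)\<^sup>2 + (norm u)\<^sup>2 - 2 * (z \<bullet> u)"
    unfolding power2_norm_eq_inner by (simp add: inner_diff inner_commute)
  then have re: "(norm (z - u))\<^sup>2 = (norm z)\<^sup>2 + (norm u)\<^sup>2 - 2 * Re s"
    by (simp add: s_def Re_hprod)
  have "\<i> / 2 * of_real (Im (hprod z (z - u))) + of_real (- (a / 4) * (norm (z - u))\<^sup>2) =
      of_real (- (a / 4) * (norm z)\<^sup>2) + (of_real (- (a / 4) * (norm u)\<^sup>2) +
      (of_real ((a + 1) / 4) * cnj s + of_real ((a - 1) / 4) * s))"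
    unfolding im re by (simp add: complex_eq_iff field_simps)
  then have "exp (\<i> / 2 * of_real (Im (hprod z (z - u)))) * exp (of_real (- (a / 4) * (norm (z - u))\<^sup>2)) =
      exp (of_real (- (a / 4) * (norm z)\<^sup>2)) * (exp (of_real (- (a / 4) * (norm u)\<^sup>2)) *
      exp (of_real ((a + 1) / 4) * cnj s + of_real ((a - 1) / 4) * s))"
    by (simp only: exp_add[symmetric])
  then show ?thesis by (simp only: s' s_def exp_of_real)
qed

lemma twisted_gaussian_convolution:
  assumes [measurable]: "f \<in> borel_measurable borel"
  shows "(\<integral>w. twisted_translate f z w * gaussian (a / 4) w \<partial>lborel) = gaussian (a / 4) z *
    (\<integral>u. (f u * gaussian (a / 4) u) *
      exp (of_real ((a + 1) / 4) * hprod u z + of_real ((a - 1) / 4) * hprod z u) \<partial>lborel)"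
proof -
  let ?g = "\<lambda>w. twisted_translate f z w * gaussian (a / 4) w"
  have "integral\<^sup>L lborel ?g = (\<integral>u. ?g (z + (- 1) *\<^sub>R u) \<partial>lborel)"
    by (subst integral_lborel_affine[of "- 1" _ z]) simp_all
  also have "\<dots> = (\<integral>u. gaussian (a / 4) z * ((f u * gaussian (a / 4) u) *
      exp (of_real ((a + 1) / 4) * hprod u z + of_real ((a - 1) / 4) * hprod z u)) \<partial>lborel)"
  proof (rule Bochner_Integration.integral_cong[OF refl])
    fix u
    have "?g (z + (- 1) *\<^sub>R u) = f u * (exp (\<i> / 2 * of_real (Im (hprod z (z - u)))) * gaussian (a / 4) (z - u))"
      by (simp add: twisted_translate_def mult.assoc)
    then show "?g (z + (- 1) *\<^sub>R u) = gaussian (a / 4) z * ((f u * gaussian (a / 4) u) *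
      exp (of_real ((a + 1) / 4) * hprod u z + of_real ((a - 1) / 4) * hprod z u))"
      unfolding twisted_gaussian_kernel by (simp only: mult_ac)
  qed
  also have "\<dots> = gaussian (a / 4) z *
    (\<integral>u. (f u * gaussian (a / 4) u) *
      exp (of_real ((a + 1) / 4) * hprod u z + of_real ((a - 1) / 4) * hprod z u) \<partial>lborel)"
    by (rule integral_mult_right_zero)
  finally show ?thesis .
qed

text \<open>
  For \<open>p \<ge> 1\<close> one has \<open>x \<le> 1 + x powr p\<close> on the non-negative reals, which avoids the Hoelder inequality.
\<close>
lemma exp_integrable_Lp_gaussian:
  fixes f :: "'a::euclidean_space \<Rightarrow> complex"
  assumes [measurable]: "f \<in> borel_measurable borel"
    and int: "integrable lborel (\<lambda>u. norm (f u) powr p)" and p: "p \<ge> 1" and b: "b > 0"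
  shows "exp_integrable (\<lambda>u. f u * gaussian b u)"
  unfolding exp_integrable_def
proof (intro conjI allI)
  fix R :: real
  let ?w = "\<lambda>u::'a. exp (R * norm u) * exp (- b * (norm u)\<^sup>2)"
  let ?C = "exp (R\<^sup>2 / (4 * b))"
  have wC: "?w u \<le> ?C" for u
  proof -
    have "?w u \<le> (?C * exp (b * (norm u)\<^sup>2)) * exp (- b * (norm u)\<^sup>2)"
      by (intro mult_right_mono exp_linear_le_exp_quadratic b) auto
    also have "\<dots> = ?C" by (simp add: mult.assoc flip: exp_add)
    finally show ?thesis .
  qed
  have "integrable lborel (\<lambda>u::'a. exp (R * norm u) *\<^sub>R gaussian b u)"
    using exp_integrable_gaussian[OF b, where 'a = 'a] unfolding exp_integrable_def by blast
  from integrable_norm[OF this] have w: "integrable lborel ?w" by (simp add: norm_mult)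
  have "integrable lborel (\<lambda>u. ?w u + ?C * norm (f u) powr p)"
    by (intro Bochner_Integration.integrable_add w integrable_mult_right int)
  then show "integrable lborel (\<lambda>u. exp (R * norm u) *\<^sub>R (f u * gaussian b u))"
  proof (rule Bochner_Integration.integrable_bound)
    have "norm (exp (R * norm u) *\<^sub>R (f u * gaussian b u)) \<le> norm (?w u + ?C * norm (f u) powr p)" for u
    proof -
      have "norm (f u) \<le> 1 + norm (f u) powr p"
      proof (cases "norm (f u) \<le> 1")
        case False
        then have "norm (f u) powr 1 \<le> norm (f u) powr p" using p by (intro powr_mono) auto
        then show ?thesis using False by simp
      qed (simp add: add_increasing2)
      then have "?w u * norm (f u) \<le> ?w u * (1 + norm (f u) powr p)"
        by (intro mult_left_mono) auto
      also have "\<dots> \<le> ?w u + ?C * norm (f u) powr p"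
        using mult_right_mono[OF wC[of u], of "norm (f u) powr p"] by (simp add: distrib_left)
      finally show ?thesis by (simp add: norm_mult mult_ac)
    qed
    then show "AE u in lborel. norm (exp (R * norm u) *\<^sub>R (f u * gaussian b u)) \<le> norm (?w u + ?C * norm (f u) powr p)"
      by simp
  qed measurable
qed measurable

lemma lebesgue_measurable_eq_borel_AE:
  fixes f :: "'a::euclidean_space \<Rightarrow> complex"
  assumes "f \<in> borel_measurable lebesgue"
  obtains g where "g \<in> borel_measurable borel" "AE x in lborel. f x = g x"
proof -
  have "(\<lambda>x. Re (f x)) \<in> borel_measurable lebesgue" "(\<lambda>x. Im (f x)) \<in> borel_measurable lebesgue"
    using assms by auto
  from this[THEN completion_ex_borel_measurable_real] obtain a b
    where "a \<in> borel_measurable lborel" "AE x in lborel. Re (f x) = a x"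
      "b \<in> borel_measurable lborel" "AE x in lborel. Im (f x) = b x"
    by blast
  then have "(\<lambda>x. Complex (a x) (b x)) \<in> borel_measurable borel"
      "AE x in lborel. f x = Complex (a x) (b x)"
    by (auto simp: borel_measurable_complex_iff complex_eq_iff)
  then show thesis by (rule that)
qed

text \<open>
  The left-hand side is the negative derivative with respect to \<open>a\<close> of a function of \<open>a\<close> that vanishes
  on the whole half-line.
\<close>
lemma mixed_moment_mult_norm_sq_eq_0:
  fixes f :: "complex ^ 'n \<Rightarrow> complex"
  assumes K: "\<And>a. a > a0 \<Longrightarrow> exp_integrable (\<lambda>u. f u * gaussian a u)"
    and zero: "\<And>a. a > a0 \<Longrightarrow> mixed_moment (\<lambda>u. f u * gaussian a u) p q z = 0" and a: "a > a0"
  shows "mixed_moment (\<lambda>u. of_real ((norm u)\<^sup>2) * (f u * gaussian a u)) p q z = 0"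
proof -
  let ?K = "\<lambda>u. (f u * gaussian a u) * (hprod u z ^ q * hprod z u ^ p)"
  define \<epsilon> where "\<epsilon> = (a - a0) / 2"
  have \<epsilon>: "\<epsilon> > 0" "a - \<epsilon> > a0" using a by (auto simp: \<epsilon>_def field_simps)
  have shift: "gaussian a u * of_real (exp (t * (norm u)\<^sup>2)) = gaussian (a - t) u" for t and u :: "complex ^ 'n"
    by (simp add: algebra_simps flip: of_real_mult exp_add)
  have "(\<integral>u. ?K u * (of_real ((norm u)\<^sup>2)) ^ 1 \<partial>lborel) = 0"
  proof (rule moments_eq_0_if_exp_integral_eq_0[where \<epsilon> = \<epsilon>])
    show "?K \<in> borel_measurable lborel"
      using mixed_moment_integrable[OF K[OF a], of z q p] by auto
    have "exp (\<epsilon> * norm (of_real ((norm u)\<^sup>2) :: complex)) *\<^sub>R ?K u =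
        (f u * gaussian (a - \<epsilon>) u) * (hprod u z ^ q * hprod z u ^ p)" for u
      unfolding shift[symmetric] by (simp add: scaleR_conv_of_real norm_power mult_ac)
    then show "integrable lborel (\<lambda>u. exp (\<epsilon> * norm (of_real ((norm u)\<^sup>2) :: complex)) *\<^sub>R ?K u)"
      using mixed_moment_integrable[OF K[OF \<epsilon>(2)], of z q p] by simp
    fix t :: real assume t: "\<bar>t\<bar> < \<epsilon>"
    have exp_t: "exp (of_real t * of_real ((norm u)\<^sup>2)) = (of_real (exp (t * (norm u)\<^sup>2)) :: complex)" for u :: "complex ^ 'n"
      by (simp only: exp_of_real flip: of_real_mult)
    have eq: "?K u * exp (of_real t * of_real ((norm u)\<^sup>2)) =
        (f u * gaussian (a - t) u) * (hprod u z ^ q * hprod z u ^ p)" for u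
      unfolding shift[symmetric] exp_t by (simp only: mult_ac)
    have "a - t > a0" using t \<epsilon> by linarith
    then show "(\<integral>u. ?K u * exp (of_real t * of_real ((norm u)\<^sup>2)) \<partial>lborel) = 0"
      unfolding eq by (rule zero[of "a - t", unfolded mixed_moment_def])
  qed (use \<epsilon> in auto)
  then show ?thesis
    unfolding mixed_moment_def by (simp add: mult_ac)
qed

text \<open>
  The mixed moment of bidegree \<open>(p, q)\<close> is a bihomogeneous polynomial in \<open>z\<close>. Its Laplacian is a multiple of
  a moment of bidegree \<open>(p - 1, q - 1)\<close> with the additional weight \<open>\<bar>u\<bar>\<^sup>2\<close>, which is up to sign the derivative in \<open>a\<close> of a
  moment that vanishes by induction (and the multiple is \<open>0\<close> if \<open>p = 0\<close> or \<open>q = 0\<close>). So it is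
  harmonic, and as it vanishes on \<open>C\<close> it is \<open>0\<close>.
\<close>
lemma mixed_moments_eq_0_everywhere:
  fixes f :: "complex ^ 'n \<Rightarrow> complex"
  assumes K: "\<And>a. a > a0 \<Longrightarrow> exp_integrable (\<lambda>u. f u * gaussian a u)"
    and C: "\<And>a p q z. a > a0 \<Longrightarrow> z \<in> C \<Longrightarrow> mixed_moment (\<lambda>u. f u * gaussian a u) p q z = 0"
    and harm: "\<And>s t P. P \<in> solid_harmonics s t \<Longrightarrow> C \<subseteq> P -` {0} \<Longrightarrow> P = (\<lambda>_. 0)"
    and a: "a > a0"
  shows "mixed_moment (\<lambda>u. f u * gaussian a u) p q z = 0"
  using a
proof (induction p arbitrary: q a z)
  case 0
  let ?I = "mixed_moment (\<lambda>u. f u * gaussian a u) 0 q"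
  have "?I \<in> solid_harmonics 0 q"
    using mixed_moment_laplacian[OF K[OF 0], of 0 q] by (simp add: solid_harmonics_def)
  moreover have "C \<subseteq> ?I -` {0}" using C[OF 0] by auto
  ultimately have "?I = (\<lambda>_. 0)" by (rule harm)
  then show ?case by (simp add: fun_eq_iff)
next
  case (Suc p)
  let ?I = "mixed_moment (\<lambda>u. f u * gaussian a u) (Suc p) q"
  have "mixed_moment (\<lambda>u. of_real ((norm u)\<^sup>2) * (f u * gaussian a u)) p (q - 1) w = 0" for w
    by (rule mixed_moment_mult_norm_sq_eq_0[OF K Suc.IH Suc.prems])
  then have "?I \<in> solid_harmonics (Suc p) q"
    using mixed_moment_laplacian[OF K[OF Suc.prems], of "Suc p" q] by (simp add: solid_harmonics_def)
  moreover have "C \<subseteq> ?I -` {0}" using C[OF Suc.prems] by auto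
  ultimately have "?I = (\<lambda>_. 0)" by (rule harm)
  then show ?case by (simp add: fun_eq_iff)
qed

lemma complex_cone_smult: "is_complex_cone C \<Longrightarrow> z \<in> C \<Longrightarrow> c *s z \<in> C"
  unfolding is_complex_cone_def by blast

text \<open>
  Integrating the spherical means against Gaussians in the radius gives, at every point of the
  cone, vanishing exponential integrals of \<open>f\<close> times a Gaussian. As \<open>C\<close> is a cone, the mixed moments
  vanish on \<open>C\<close>, then everywhere by harmonicity, and they determine \<open>f\<close>.
\<close>
lemma injectivity_if_no_harmonic_vanishes:
  fixes C :: "(complex ^ 'n) set"
  assumes cone: "is_complex_cone C" and p: "1 \<le> p"
    and harm: "\<And>s t P. P \<in> solid_harmonics s t \<Longrightarrow> C \<subseteq> P -` {0} \<Longrightarrow> P = (\<lambda>_. 0)"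
    and f: "f \<in> Lp p" and means: "\<And>z r. z \<in> C \<Longrightarrow> r > 0 \<Longrightarrow> twisted_spherical_mean f r z = 0"
  shows "AE z in lebesgue. f z = 0"
proof -
  obtain g where g [measurable]: "g \<in> borel_measurable borel" and fg: "AE x in lborel. f x = g x"
    using f lebesgue_measurable_eq_borel_AE[of f] unfolding Lp_def by blast
  have "integrable lebesgue (\<lambda>u. norm (g u) powr p)"
  proof (rule integrable_cong_AE_imp)
    show "integrable lebesgue (\<lambda>u. norm (f u) powr p)" using f by (simp add: Lp_def)
    show "(\<lambda>u. norm (g u) powr p) \<in> borel_measurable lebesgue" by (intro measurable_completion) simp
    show "AE u in lebesgue. norm (f u) powr p = norm (g u) powr p"
      using AE_completion[OF fg] by eventually_elim simp
  qed
  then have gp: "integrable lborel (\<lambda>u. norm (g u) powr p)"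
    by (subst (asm) integrable_completion) auto
  have K: "exp_integrable (\<lambda>u. g u * gaussian b u)" if "b > 0" for b
    by (rule exp_integrable_Lp_gaussian[OF g gp p that])
  \<comment> \<open>The restriction \<open>a > 1\<close> keeps both coefficients \<open>(a + 1) / 4\<close> and \<open>(a - 1) / 4\<close> away from \<open>0\<close>, so that all bidegrees can be read off.\<close>
  have conv0: "(\<integral>u. (g u * gaussian (a / 4) u) *
      exp (of_real ((a + 1) / 4) * hprod u z + of_real ((a - 1) / 4) * hprod z u) \<partial>lborel) = 0"
    if z: "z \<in> C" and a: "a > 1" for z a
  proof -
    have ae: "AE w in lborel. twisted_translate f z w = twisted_translate g z w"
    proof -
      obtain N where N: "{x. f x \<noteq> g x} \<subseteq> N" "N \<in> sets borel" "emeasure lborel N = 0"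
        using fg by (auto elim!: AE_E)
      have "distr lborel borel (\<lambda>w. z - w) = lborel"
        using lborel_affine[of "- 1" z] by (simp add: density_1)
      moreover have "AE x in lborel. x \<notin> N"
        using N by (intro AE_not_in) (auto simp: null_sets_def)
      ultimately have "AE x in distr lborel borel (\<lambda>w. z - w). x \<notin> N" by (simp only:)
      then have "AE w in lborel. z - w \<notin> N"
        using N(2) by (subst (asm) AE_distr_iff) auto
      then show ?thesis
        by eventually_elim (use N(1) in \<open>auto simp: twisted_translate_def\<close>)
    qed
    have "integrable lborel (\<lambda>w. twisted_translate g z w * gaussian (a / 4) w)"
    proof -
      let ?h = "\<lambda>u. gaussian (a / 4) z * ((g u * gaussian (a / 4) u) *
        exp (of_real ((a + 1) / 4) * hprod u z + of_real ((a - 1) / 4) * hprod z u))"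
      have "integrable lborel (\<lambda>u. (g u * gaussian (a / 4) u) *
        exp (of_real ((a + 1) / 4) * hprod u z + of_real ((a - 1) / 4) * hprod z u))"
        by (rule exp_integrable_exp_linear[OF K bounded_linear_hprod_combination]) (use a in simp)
      then have "integrable lborel ?h" by (rule integrable_mult_right)
      then have "integrable lborel (\<lambda>w. ?h (z + (- 1) *\<^sub>R w))"
        by (rule integrable_lborel_affine[rotated]) simp
      moreover have "?h (z + (- 1) *\<^sub>R w) = twisted_translate g z w * gaussian (a / 4) w" for w
        using twisted_gaussian_kernel[of z "z - w" a] by (simp add: twisted_translate_def mult_ac)
      ultimately show ?thesis by simp
    qed
    then have "(\<integral>w. twisted_translate g z w * gaussian (a / 4) w \<partial>lborel) = 0"
      using radial_integral_eq_0_if_sphere_integrals_eq_0[OF ae, of "\<lambda>s. of_real (exp (- (a / 4) * s\<^sup>2))"]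
        means[OF z] by (simp add: twisted_spherical_mean_eq)
    then show ?thesis
      unfolding twisted_gaussian_convolution[OF g] by simp
  qed
  have zeroC: "mixed_moment (\<lambda>u. g u * gaussian b u) q q' z = 0" if b: "b > 1 / 4" and z: "z \<in> C" for b q q' z
  proof (rule mixed_moments_eq_0_if_exp_integral_eq_0)
    show "exp_integrable (\<lambda>u. g u * gaussian b u)" by (rule K) (use b in simp)
    show "complex_of_real ((4 * b + 1) / 4) \<noteq> 0" "complex_of_real ((4 * b - 1) / 4) \<noteq> 0"
      using b by (auto simp del: of_real_divide of_real_diff of_real_add)
    show "(\<integral>u. g u * gaussian b u * exp (of_real ((4 * b + 1) / 4) * hprod u (c *s z) +
        of_real ((4 * b - 1) / 4) * hprod (c *s z) u) \<partial>lborel) = 0" for c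
      using conv0[OF complex_cone_smult[OF cone z, of c], of "4 * b"] b by simp
  qed
  have zero: "mixed_moment (\<lambda>u. g u * gaussian b u) q q' z = 0" if "b > 1 / 4" for b q q' z
    by (rule mixed_moments_eq_0_everywhere[where C = C and ?a0.0 = "1 / 4"]) (use K zeroC harm that in auto)
  have "AE u in lborel. g u * gaussian (1 / 4) u = 0"
  proof (rule AE_eq_0_if_gaussian_exp_integrals_eq_0)
    show "integrable lborel (\<lambda>u. g u * gaussian (1 / 4) u)"
      by (intro exp_integrable_integrable K) simp
    fix a :: real and y :: "complex ^ 'n" assume a: "a > 0"
    have merge: "g u * gaussian (1 / 4) u * gaussian a u = g u * gaussian (1 / 4 + a) u" for u
      by (simp add: mult.assoc algebra_simps flip: of_real_mult exp_add)
    have split: "of_real (u \<bullet> y) = 1 / 2 * hprod u y + 1 / 2 * hprod y u" for u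
      using hprod_add_hprod[of u y] by (simp add: field_simps)
    show "(\<integral>u. g u * gaussian (1 / 4) u * gaussian a u * exp (of_real (u \<bullet> y)) \<partial>lborel) = 0"
      unfolding merge split
      by (rule exp_integral_eq_0_if_mixed_moments_eq_0[OF K zero]) (use a in simp_all)
  qed
  then have "AE u in lborel. f u = 0"
    using fg by eventually_elim simp
  then show ?thesis by (simp add: AE_completion_iff)
qed

text \<open>
  By homogeneity \<open>P\<close> vanishes on the complex line through \<open>z\<close>. The mean value property at a point \<open>x\<close> of this
  line says that the integral of \<open>P u exp (- b \<bar>u - x\<bar>\<^sup>2)\<close> is \<open>0\<close>. Up to a Gaussian in \<open>x\<close> this is the
  exponential integral whose coefficients along the line are the mixed moments.
\<close>
lemma harmonic_mixed_moments_eq_0: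
  fixes P :: "complex ^ 'n \<Rightarrow> complex"
  assumes P: "P \<in> solid_harmonics s t" and z: "P z = 0" and b: "b > 0"
  shows "mixed_moment (\<lambda>u. P u * gaussian b u) p q z = 0"
proof -
  obtain c where c: "P = bihomogeneous_poly s t c" and harm: "\<And>z. laplacian P z = 0"
    using P by (auto simp: solid_harmonics_def)
  have poly: "polyfun P" unfolding c by (rule polyfun_bihomogeneous_poly)
  have [measurable]: "P \<in> borel_measurable borel" using poly by measurable
  show ?thesis
  proof (rule mixed_moments_eq_0_if_exp_integral_eq_0)
    show "exp_integrable (\<lambda>u. P u * gaussian b u)"
      by (intro exp_integrable_mult polyfun_exp_growth poly exp_integrable_gaussian b)
    show "complex_of_real b \<noteq> 0" "complex_of_real b \<noteq> 0" using b by auto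
    fix \<zeta> :: complex
    let ?x = "\<zeta> *s z"
    have "P ?x = 0" using z unfolding c by (simp add: bihomogeneous_poly_smult)
    then have "0 = (\<integral>u. P (?x + u) * gaussian b u \<partial>lborel)"
      by (simp only: gaussian_mean_value[OF poly harm b] mult_zero_left)
    also have "\<dots> = (\<integral>u. P u * gaussian b (u - ?x) \<partial>lborel)"
      by (subst (2) integral_lborel_affine[of 1 _ ?x]) auto
    also have "\<dots> = (\<integral>u. gaussian b ?x * (P u * gaussian b u * exp (of_real b * hprod u ?x + of_real b * hprod ?x u)) \<partial>lborel)"
    proof (rule Bochner_Integration.integral_cong[OF refl])
      fix u
      have "of_real b * hprod u ?x + of_real b * hprod ?x u = (of_real (2 * b * (u \<bullet> ?x)) :: complex)"
        by (simp only: distrib_left[symmetric] hprod_add_hprod) simp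
      then show "P u * gaussian b (u - ?x) =
          gaussian b ?x * (P u * gaussian b u * exp (of_real b * hprod u ?x + of_real b * hprod ?x u))"
        by (simp only: gaussian_diff mult_ac)
    qed
    also have "\<dots> = gaussian b ?x * (\<integral>u. P u * gaussian b u * exp (of_real b * hprod u ?x + of_real b * hprod ?x u) \<partial>lborel)"
      by (rule integral_mult_right_zero)
    finally show "(\<integral>u. P u * gaussian b u * exp (of_real b * hprod u ?x + of_real b * hprod ?x u) \<partial>lborel) = 0"
      by simp
  qed
qed

lemma gaussian_exp_growth_bounded:
  assumes "exp_growth P" "b > 0"
  shows "\<exists>B. \<forall>u. norm (P u * gaussian b u) \<le> B"
proof -
  obtain C R where CR: "C \<ge> 0" "R \<ge> 0" "\<And>u. norm (P u) \<le> C * exp (R * norm u)"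
    using exp_growthE[OF assms(1)] by blast
  have "norm (P u * gaussian b u) \<le> C * exp (R\<^sup>2 / (4 * b))" for u
  proof -
    have "norm (P u * gaussian b u) \<le> (C * exp (R * norm u)) * exp (- b * (norm u)\<^sup>2)"
      unfolding norm_mult norm_of_real abs_exp_cancel using CR(3) by (intro mult_right_mono) auto
    also have "\<dots> \<le> (C * (exp (R\<^sup>2 / (4 * b)) * exp (b * (norm u)\<^sup>2))) * exp (- b * (norm u)\<^sup>2)"
      using CR(1) exp_linear_le_exp_quadratic[OF assms(2)] by (intro mult_right_mono mult_left_mono) auto
    also have "\<dots> = C * exp (R\<^sup>2 / (4 * b))" by (simp add: mult.assoc flip: exp_add)
    finally show ?thesis .
  qed
  then show ?thesis by blast
qed

lemma gaussian_exp_growth_Lp: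
  fixes P :: "'a::euclidean_space \<Rightarrow> complex"
  assumes P: "exp_growth P" and b: "b > 0" and p: "p > 0"
  shows "(\<lambda>u. P u * gaussian b u) \<in> Lp p"
proof -
  have [measurable]: "P \<in> borel_measurable borel" using P by measurable
  obtain C R where CR: "C \<ge> 0" "R \<ge> 0" "\<And>u. norm (P u) \<le> C * exp (R * norm u)"
    using exp_growthE[OF P] by blast
  have "integrable lborel (\<lambda>u::'a. exp ((p * R) * norm u) *\<^sub>R gaussian (p * b) u)"
    using exp_integrable_gaussian[of "p * b", where 'a = 'a] b p unfolding exp_integrable_def by simp
  from integrable_norm[OF this]
  have "integrable lborel (\<lambda>u::'a. C powr p * (exp ((p * R) * norm u) * exp (- (p * b) * (norm u)\<^sup>2)))"
    by (intro integrable_mult_right) (simp add: norm_mult)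
  then have "integrable lborel (\<lambda>u. norm (P u * gaussian b u) powr p)"
  proof (rule Bochner_Integration.integrable_bound)
    have "norm (P u * gaussian b u) powr p \<le>
        C powr p * (exp ((p * R) * norm u) * exp (- (p * b) * (norm u)\<^sup>2))" for u
    proof -
      have "norm (P u * gaussian b u) \<le> C * exp (R * norm u) * exp (- b * (norm u)\<^sup>2)"
        unfolding norm_mult norm_of_real abs_exp_cancel using CR(3) by (intro mult_right_mono) auto
      then have "norm (P u * gaussian b u) powr p \<le> (C * exp (R * norm u) * exp (- b * (norm u)\<^sup>2)) powr p"
        using p by (intro powr_mono2) auto
      also have "\<dots> = C powr p * (exp ((p * R) * norm u) * exp (- (p * b) * (norm u)\<^sup>2))"
        using CR(1) by (simp add: powr_mult exp_powr_real mult_ac)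
      finally show ?thesis .
    qed
    then show "AE u in lborel. norm (norm (P u * gaussian b u) powr p) \<le>
        norm (C powr p * (exp ((p * R) * norm u) * exp (- (p * b) * (norm u)\<^sup>2)))"
      by simp
  qed measurable
  then show ?thesis
    unfolding Lp_def by (auto intro!: measurable_completion simp: integrable_completion)
qed

text \<open>
  All mixed moments at \<open>z\<close> of \<open>P\<close> times a Gaussian vanish, hence so do the exponential integrals that arise
  when the spherical means at \<open>z\<close> are integrated against Gaussians in the radius. The means are continuous in
  the radius, so they vanish for every radius.
\<close>
lemma harmonic_gaussian_twisted_mean_eq_0:
  fixes P :: "complex ^ 'n \<Rightarrow> complex"
  assumes P: "P \<in> solid_harmonics s t" and z: "P z = 0" and r: "r > 0"
  shows "twisted_spherical_mean (\<lambda>u. P u * gaussian (1 / 4) u) r z = 0"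
proof -
  let ?f = "\<lambda>u. P u * gaussian (1 / 4) u"
  obtain c where c: "P = bihomogeneous_poly s t c" using P by (auto simp: solid_harmonics_def)
  have poly: "polyfun P" unfolding c by (rule polyfun_bihomogeneous_poly)
  have [measurable]: "P \<in> borel_measurable borel" using poly by measurable
  have f_meas [measurable]: "?f \<in> borel_measurable borel" by measurable
  obtain B where B: "\<And>u. norm (?f u) \<le> B"
    using gaussian_exp_growth_bounded[OF polyfun_exp_growth[OF poly], of "1 / 4"] by auto
  let ?k = "twisted_translate ?f z"
  define m where "m r = integral\<^sup>L (sphere_measure r) ?k" for r
  have k_bnd: "norm (?k w) \<le> B" for w using B by (simp only: norm_twisted_translate)
  have k_cont: "continuous_on UNIV ?k"
    unfolding twisted_translate_def
    by (intro continuous_intros continuous_on_compose2[OF polyfun_continuous_on[OF poly, of UNIV]]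
        continuous_on_hprod_right) auto
  have m_cont: "continuous_on UNIV m" and m_bnd: "norm (m r) \<le> B" for r
    using continuous_on_sphere_integral[OF k_cont k_bnd] by (simp_all add: m_def[abs_def])
  have [measurable]: "m \<in> borel_measurable borel" using m_cont by (rule borel_measurable_continuous_onI)
  let ?N = "DIM(complex ^ 'n)" and ?V = "measure lborel (ball 0 1 :: (complex ^ 'n) set)"
  obtain C R where CR: "\<And>r. norm (of_real (?V * real ?N) * (of_real r ^ (?N - 1)) * m r) \<le> C * exp (R * norm r)"
  proof -
    have "exp_growth (\<lambda>r::real. of_real (?V * real ?N) * (of_real r ^ (?N - 1)) :: complex)"
      by (intro exp_growth_mult exp_growth_power exp_growth_const exp_growth_linear bounded_linear_of_real)
    moreover have "exp_growth m"
      by (rule exp_growthI[where C = B and R = 0]) (auto simp: m_bnd)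
    ultimately have "exp_growth (\<lambda>r. of_real (?V * real ?N) * (of_real r ^ (?N - 1)) * m r)"
      by (rule exp_growth_mult)
    then show thesis using that exp_growthE by blast
  qed
  have "AE r in lborel. r > 0 \<longrightarrow> of_real (?V * (real ?N * r ^ (?N - 1))) * m r = 0"
  proof (rule half_line_gaussian_uniqueness)
    show "norm (of_real (?V * (real ?N * r ^ (?N - 1))) * m r) \<le> C * exp (R * \<bar>r\<bar>)" for r
      using CR[of r] by (simp add: norm_mult norm_power abs_mult power_abs mult_ac)
    fix a :: real assume a: "a > 0"
    let ?\<rho> = "\<lambda>s. complex_of_real (exp (- a * s\<^sup>2))"
    have "integrable lborel (\<lambda>w. ?k w * gaussian a w)"
    proof (rule Bochner_Integration.integrable_bound)
      show "integrable lborel (\<lambda>w::complex ^ 'n. B * exp (- a * (norm w)\<^sup>2))"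
        using a by (intro integrable_mult_right integrable_gaussian)
      show "AE w in lborel. norm (?k w * gaussian a w) \<le> norm (B * exp (- a * (norm w)\<^sup>2))"
        using k_bnd order_trans[OF norm_ge_zero k_bnd]
        by (intro AE_I2) (simp add: norm_mult abs_mult mult_right_mono)
    qed measurable
    from integral_polar[OF this]
    have "(\<integral>w. ?k w * gaussian a w \<partial>lborel) =
        (\<integral>r. (indicator {0<..} r * (?V * (real ?N * r ^ (?N - 1)))) *\<^sub>R
          (\<integral>w. ?k w * gaussian a w \<partial>sphere_measure r) \<partial>lborel)" .
    also have "\<dots> = (\<integral>r. indicator {0<..} r *\<^sub>R (of_real (?V * (real ?N * r ^ (?N - 1))) * m r * gaussian a r) \<partial>lborel)"
    proof (rule Bochner_Integration.integral_cong[OF refl])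
      fix r :: real
      show "(indicator {0<..} r * (?V * (real ?N * r ^ (?N - 1)))) *\<^sub>R (\<integral>w. ?k w * gaussian a w \<partial>sphere_measure r) =
          indicator {0<..} r *\<^sub>R (of_real (?V * (real ?N * r ^ (?N - 1))) * m r * gaussian a r)"
      proof (cases "r > 0")
        case True
        have "(\<integral>w. ?k w * ?\<rho> (norm w) \<partial>sphere_measure r) = m r * ?\<rho> r"
          unfolding m_def by (rule sphere_integral_mult_radial) (use True in auto)
        then show ?thesis using True by (simp add: scaleR_conv_of_real mult.assoc)
      qed simp
    qed
    finally have "(\<integral>r. indicator {0<..} r *\<^sub>R (of_real (?V * (real ?N * r ^ (?N - 1))) * m r * gaussian a r) \<partial>lborel) =
        (\<integral>w. ?k w * gaussian (4 * a / 4) w \<partial>lborel)" by simp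
    also have "\<dots> = 0"
    proof -
      have "?f u * gaussian (4 * a / 4) u = P u * gaussian (1 / 4 + a) u" for u
        by (simp add: mult.assoc algebra_simps flip: of_real_mult exp_add)
      moreover have "exp_integrable (\<lambda>u. P u * gaussian (1 / 4 + a) u)"
        using a by (intro exp_integrable_mult polyfun_exp_growth poly exp_integrable_gaussian) simp
      moreover have "mixed_moment (\<lambda>u. P u * gaussian (1 / 4 + a) u) p q z = 0" for p q
        using a by (intro harmonic_mixed_moments_eq_0[OF P z]) simp
      ultimately show ?thesis
        unfolding twisted_gaussian_convolution[OF f_meas]
        by (simp only: exp_integral_eq_0_if_mixed_moments_eq_0 mult_zero_right)
    qed
    finally show "(\<integral>r. indicator {0<..} r *\<^sub>R (of_real (?V * (real ?N * r ^ (?N - 1))) * m r * gaussian a r) \<partial>lborel) = 0" .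
  qed measurable
  then have "AE r\<in>{0<..} in lebesgue. r \<in> {r. m r = 0}"
    using measure_unit_ball_pos[where 'a = "complex ^ 'n"]
    by (auto simp: AE_completion_iff elim!: eventually_mono)
  then have "r \<in> {r. m r = 0}"
  proof (rule mem_closed_if_AE_lebesgue_open[rotated 2])
    show "closed {r. m r = 0}" using m_cont by (intro closed_Collect_eq) (auto intro: continuous_intros)
  qed (use r in auto)
  then show ?thesis by (simp add: twisted_spherical_mean_eq m_def)
qed

lemma continuous_eq_0_if_AE_eq_0:
  fixes P :: "'a::euclidean_space \<Rightarrow> complex"
  assumes cont: "continuous_on UNIV P" and ae: "AE z in lebesgue. P z = 0"
  shows "P z = 0"
proof -
  have "z \<in> {z. P z = 0}"
  proof (rule mem_closed_if_AE_lebesgue)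
    show "closed {z. P z = 0}" using cont by (intro closed_Collect_eq) (auto intro: continuous_intros)
  qed (use ae in auto)
  then show ?thesis by simp
qed

theorem proposition4p4:
  fixes C :: "(complex ^ 'n) set" and p :: real
  assumes "CARD('n) \<ge> 2" and "is_complex_cone C" and "1 \<le> p" and "p \<le> 2"
  shows "(\<forall>f\<in>Lp p. (\<forall>z\<in>C. \<forall>r>0. twisted_spherical_mean f r z = 0) \<longrightarrow>
             (AE z in lebesgue. f z = 0)) \<longleftrightarrow>
         (\<forall>s t. \<forall>P\<in>solid_harmonics s t. P \<noteq> (\<lambda>_. 0) \<longrightarrow> \<not> C \<subseteq> P -` {0})"
proof
  assume inj: "\<forall>f\<in>Lp p. (\<forall>z\<in>C. \<forall>r>0. twisted_spherical_mean f r z = 0) \<longrightarrow> (AE z in lebesgue. f z = 0)"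
  show "\<forall>s t. \<forall>P\<in>solid_harmonics s t. P \<noteq> (\<lambda>_. 0) \<longrightarrow> \<not> C \<subseteq> P -` {0}"
  proof (intro allI ballI impI notI)
    fix s t and P :: "complex ^ 'n \<Rightarrow> complex"
    assume P: "P \<in> solid_harmonics s t" and ne: "P \<noteq> (\<lambda>_. 0)" and C: "C \<subseteq> P -` {0}"
    let ?f = "\<lambda>u. P u * gaussian (1 / 4) u"
    have poly: "polyfun P" using P by (auto simp: solid_harmonics_def polyfun_bihomogeneous_poly)
    have "?f \<in> Lp p"
      using assms(3) by (intro gaussian_exp_growth_Lp polyfun_exp_growth poly) auto
    moreover have "\<forall>z\<in>C. \<forall>r>0. twisted_spherical_mean ?f r z = 0"
      using C by (intro ballI allI impI harmonic_gaussian_twisted_mean_eq_0[OF P]) auto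
    ultimately have "AE z in lebesgue. ?f z = 0" using inj by blast
    then have "AE z in lebesgue. P z = 0" by eventually_elim simp
    then have "P z = 0" for z
      by (rule continuous_eq_0_if_AE_eq_0[OF polyfun_continuous_on[OF poly]])
    then show False using ne by auto
  qed
next
  assume "\<forall>s t. \<forall>P\<in>solid_harmonics s t. P \<noteq> (\<lambda>_. 0) \<longrightarrow> \<not> C \<subseteq> P -` {0}"
  then show "\<forall>f\<in>Lp p. (\<forall>z\<in>C. \<forall>r>0. twisted_spherical_mean f r z = 0) \<longrightarrow> (AE z in lebesgue. f z = 0)"
    using assms(2,3) by (intro ballI impI injectivity_if_no_harmonic_vanishes[where C = C and p = p]) blast+
qed

end
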